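(* Let $H$ and $E$ be essentially finite $\mathbb{R}$-hierarchical clusterings of sets $X$ and $Y$ respectively. Let $n\ge1$, and assume there is $\epsilon<\mathrm{gapsize}_n(H)/16$ such that $H$ and $E$ are $\epsilon$-interleaved with respect to a correspondence $R\subseteq X\times Y$. Then there is a bijection $m:\mathsf{PF}(H,n)\to\mathsf{PF}(E,n)$ such that for all $\mathbf{C}\in\mathsf{PF}(H,n)$, $\mathbf{C}$ and $m(\mathbf{C})$ are $3\epsilon$-interleaved with respect to $R$.
   Context: Hierarchical clusterings. A clustering of a set $X$ is a set of non-empty, pairwise disjoint subsets of $X$. $\mathsf{C}(X)$ is the poset of clusterings, where $S\preceq T$ if every $A\in S$ is contained in some $B\in T$. For an interval $I\subseteq\mathbb{R}$, an $I$-hierarchical clustering ($I$-HC) of $X$ is an order-preserving map $H:I\to\mathsf{C}(X)$. Its extension $\bar H:\mathbb{R}\to\mathsf{C}(X)$: $\bar H(r)=H(r)$ if $r\in I$; $\{X\}$ if $r\notin I$ and there is $p\in I$ with $p<r$; $\emptyset$ otherwise. For $\epsilon\ge0$, HCs $H,E$ of the same set are $\epsilon$-interleaved if $\bar H(r)\preceq\bar E(r+\epsilon)$ and $\bar E(r)\preceq\bar H(r+\epsilon)$ for all $r\in\mathbb{R}$. A correspondence between $X,Y$ is $R\subseteq X\times Y$ with surjective projections $\pi_X,\pi_Y$; $H$ (of $X$) and $E$ (of $Y$) are $\epsilon$-interleaved with respect to $R$ if $\pi_X^*(H)$ and $\pi_Y^*(E)$ are $\epsilon$-interleaved, where $\psi^*(H)(r)=\{\psi^{-1}(C):C\in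 H(r)\}$. For $r\le r'$, $H(r\le r'):H(r)\to H(r')$ sends $C$ to the unique $D\in H(r')$ with $C\subseteq D$. Persistent clusters. A persistent cluster $\mathbf{C}$ of $X$ is an interval $\mathsf{life}(\mathbf{C})\subseteq\mathbb{R}$ with an order-preserving map $\mathbf{C}$ from $\mathsf{life}(\mathbf C)$ to the power set of $X$; it is regarded as the one-parameter HC $r\mapsto\{\mathbf{C}(r)\}$ of $X$, so interleavings (using extensions) make sense. Its underlying set is $U(\mathbf{C})=\bigcup_{r}\mathbf{C}(r)$. For an $I$-HC $H$, $\mathsf{PC}(H)$ is the quotient of the disjoint union $\coprod_{r\in I}H(r)$ by the symmetric closure of: for $r_1\le r_2$, $C_1\in H(r_1)$ and $C_2\in H(r_2)$ are related iff $C_1\subseteq C_2$ and for every $r_3\in[r_1,r_2]$ there is exactly one $C_3\in H(r_3)$ with $C_3\subseteq C_2$. Each class $\mathbf{C}$ is a persistent cluster: $\mathsf{life}(\mathbf{C})=\{r:\exists C\in H(r),[C]=\mathbf{C}\}$, and $\mathbf{C}(r)$ is the unique $C\in H(r)$ with $[C]=\mathbf{C}$. Order $\mathsf{PC}(H)$ by $\mathbf{C}\le\mathbf{D}$ iff $U(\mathbf{C})\subseteq U(\mathbf{D})$. $\mathsf{leaves}(H)$ is the set of minimal elements of $\mathsf{PC}(H)$. Pruning and finiteness. For an $\mathbb{R}$-HC $H$ and $\tau\ge0$, $H_{\ge\tau}(r)=\mathrm{Im}\,H(r-\tau\le r)$. $H$ is finite if $\mathsf{PC}(H)$ is finite, and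 essentially finite if $H_{\ge\tau}$ is finite for every $\tau>0$. Prominence. For a finite $\mathbb{R}$-HC $H$, its barcode is the unique multiset of non-empty intervals $\{B_j\}_{j\in J}$ with $|\mathrm{Im}\,H(r\le r')|=|\{j:r,r'\in B_j\}|$ for all $r\le r'$; it is finite. $\mathrm{Pr}(H):\mathbb{N}\to[0,\infty]$ ($\mathbb{N}\ni0$) lists the lengths of the bars in non-increasing order, followed by zeros. For $H$ essentially finite, $\mathrm{Pr}(H)$ is the uniform limit of $\mathrm{Pr}(H_{\ge\tau})$ as $\tau\to0^+$. For $n\ge1$, $\mathrm{gap}_n(H)$ is the (possibly empty) open interval $(\mathrm{Pr}(H)(n),\mathrm{Pr}(H)(n-1))$ and $\mathrm{gapsize}_n(H)=\mathrm{Pr}(H)(n-1)-\mathrm{Pr}(H)(n)$ is its length. Persistence-based flattening. If $\mathrm{gap}_n(H)$ is non-empty, $\mathsf{PF}(H,n)=\mathsf{leaves}(H_{\ge\tau})$ with $\tau=(\mathrm{Pr}(H)(n-1)+\mathrm{Pr}(H)(n))/2$; it is a set of $n$ pairwise disjoint persistent clusters.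
   Formalization: When Pr(H)(n-1) is infinite the midpoint τ is infinite and PF(H,n) is undefined as written; there τ is taken to be Pr(n)+δ for an arbitrary fixed δ>0, the same for H and E. For finite gaps τ is the midpoint as stated. *)

theory Defs
  imports "HOL-Analysis.Analysis" "HOL-Library.Multiset" "HOL-Library.Disjoint_Sets"
begin

section \<open>Hierarchical clusterings\<close>

definition clustering :: "'a set \<Rightarrow> 'a set set \<Rightarrow> bool" where
  "clustering X S \<longleftrightarrow> S \<subseteq> Pow X \<and> {} \<notin> S \<and> disjoint S"

definition refines :: "'a set set \<Rightarrow> 'a set set \<Rightarrow> bool" where
  "refines S T \<longleftrightarrow> (\<forall>A\<in>S. \<exists>B\<in>T. A \<subseteq> B)"

text \<open>An \<open>I\<close>-hierarchical clustering of \<open>X\<close> is a function on all of \<open>real\<close> of which only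
  the values on \<open>I\<close> matter.\<close>

definition hier_clustering :: "'a set \<Rightarrow> real set \<Rightarrow> (real \<Rightarrow> 'a set set) \<Rightarrow> bool" where
  "hier_clustering X I H \<longleftrightarrow>
     is_interval I \<and> (\<forall>r\<in>I. clustering X (H r)) \<and> monotone_on I (\<le>) refines H"

definition hc_ext :: "'a set \<Rightarrow> real set \<Rightarrow> (real \<Rightarrow> 'a set set) \<Rightarrow> real \<Rightarrow> 'a set set" where
  "hc_ext X I H r = (if r \<in> I then H r else if \<exists>p\<in>I. p < r then {X} else {})"

definition interleaved ::
  "'a set \<Rightarrow> real \<Rightarrow> real set \<Rightarrow> (real \<Rightarrow> 'a set set) \<Rightarrow> real set \<Rightarrow> (real \<Rightarrow> 'a set set) \<Rightarrow> bool" where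
  "interleaved X \<epsilon> I H J E \<longleftrightarrow>
     (\<forall>r. refines (hc_ext X I H r) (hc_ext X J E (r + \<epsilon>)) \<and>
          refines (hc_ext X J E r) (hc_ext X I H (r + \<epsilon>)))"

definition correspondence :: "'a set \<Rightarrow> 'b set \<Rightarrow> ('a \<times> 'b) set \<Rightarrow> bool" where
  "correspondence X Y R \<longleftrightarrow> R \<subseteq> X \<times> Y \<and> fst ` R = X \<and> snd ` R = Y"

text \<open>Pullback along the restriction of \<open>\<psi>\<close> to \<open>Z\<close>.\<close>

definition pullback :: "'c set \<Rightarrow> ('c \<Rightarrow> 'a) \<Rightarrow> (real \<Rightarrow> 'a set set) \<Rightarrow> real \<Rightarrow> 'c set set" where
  "pullback Z \<psi> H r = (\<lambda>C. \<psi> -` C \<inter> Z) ` H r"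

definition interleaved_wrt ::
  "('a \<times> 'b) set \<Rightarrow> real \<Rightarrow> real set \<Rightarrow> (real \<Rightarrow> 'a set set) \<Rightarrow> real set \<Rightarrow> (real \<Rightarrow> 'b set set) \<Rightarrow> bool" where
  "interleaved_wrt R \<epsilon> I H J E \<longleftrightarrow>
     interleaved R \<epsilon> I (pullback R fst H) J (pullback R snd E)"

text \<open>The map \<open>H(r \<le> r')\<close>.\<close>

definition hc_map :: "(real \<Rightarrow> 'a set set) \<Rightarrow> real \<Rightarrow> real \<Rightarrow> 'a set \<Rightarrow> 'a set" where
  "hc_map H r r' C = (THE D. D \<in> H r' \<and> C \<subseteq> D)"


section \<open>Persistent clusters\<close>

text \<open>From here on, \<open>H\<close> is an \<open>\<real>\<close>-hierarchical clustering. A persistent cluster is represented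
  by its graph, a set of pairs \<open>(r, C)\<close>; elements of the disjoint union of the \<open>H r\<close> are such
  pairs, so the classes making up \<open>PC H\<close> are themselves graphs of persistent clusters.\<close>

type_synonym 'a pcluster = "(real \<times> 'a set) set"

definition life :: "'a pcluster \<Rightarrow> real set" where
  "life c = fst ` c"

definition pc_at :: "'a pcluster \<Rightarrow> real \<Rightarrow> 'a set" where
  "pc_at c r = (THE C. (r, C) \<in> c)"

definition pc_hc :: "'a pcluster \<Rightarrow> real \<Rightarrow> 'a set set" where
  "pc_hc c r = {pc_at c r}"

definition underlying :: "'a pcluster \<Rightarrow> 'a set" where
  "underlying c = (\<Union>r\<in>life c. pc_at c r)"

definition pc_rel :: "(real \<Rightarrow> 'a set set) \<Rightarrow> ((real \<times> 'a set) \<times> (real \<times> 'a set)) set" where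
  "pc_rel H = {((r1, C1), (r2, C2)). r1 \<le> r2 \<and> C1 \<in> H r1 \<and> C2 \<in> H r2 \<and> C1 \<subseteq> C2 \<and>
                  (\<forall>r3\<in>{r1..r2}. \<exists>!C3. C3 \<in> H r3 \<and> C3 \<subseteq> C2)}"

text \<open>For a hierarchical clustering, the symmetric closure of \<open>pc_rel H\<close> is already an
  equivalence relation.\<close>

definition PC :: "(real \<Rightarrow> 'a set set) \<Rightarrow> 'a pcluster set" where
  "PC H = (SIGMA r:UNIV. H r) // (pc_rel H \<union> (pc_rel H)\<inverse>)"

definition pc_le :: "'a pcluster \<Rightarrow> 'a pcluster \<Rightarrow> bool" where
  "pc_le c d \<longleftrightarrow> underlying c \<subseteq> underlying d"

definition leaves :: "(real \<Rightarrow> 'a set set) \<Rightarrow> 'a pcluster set" where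
  "leaves H = {c \<in> PC H. \<forall>d\<in>PC H. pc_le d c \<longrightarrow> d = c}"


section \<open>Pruning and finiteness\<close>

definition prune :: "real \<Rightarrow> (real \<Rightarrow> 'a set set) \<Rightarrow> real \<Rightarrow> 'a set set" where
  "prune \<tau> H r = hc_map H (r - \<tau>) r ` H (r - \<tau>)"

definition hc_finite :: "(real \<Rightarrow> 'a set set) \<Rightarrow> bool" where
  "hc_finite H \<longleftrightarrow> finite (PC H)"

definition essentially_finite :: "(real \<Rightarrow> 'a set set) \<Rightarrow> bool" where
  "essentially_finite H \<longleftrightarrow> (\<forall>\<tau>>0. hc_finite (prune \<tau> H))"


section \<open>Prominence\<close>

definition is_barcode :: "(real \<Rightarrow> 'a set set) \<Rightarrow> real set multiset \<Rightarrow> bool" where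
  "is_barcode H M \<longleftrightarrow>
     (\<forall>B\<in>#M. is_interval B \<and> B \<noteq> {}) \<and>
     (\<forall>r r'. r \<le> r' \<longrightarrow>
        card (hc_map H r r' ` H r) = size (filter_mset (\<lambda>B. r \<in> B \<and> r' \<in> B) M))"

definition barcode :: "(real \<Rightarrow> 'a set set) \<Rightarrow> real set multiset" where
  "barcode H = (THE M. is_barcode H M)"

text \<open>The prominence of a finite hierarchical clustering.\<close>

definition prominence_fin :: "(real \<Rightarrow> 'a set set) \<Rightarrow> nat \<Rightarrow> ennreal" where
  "prominence_fin H i =
     (let ls = rev (sorted_list_of_multiset (image_mset (emeasure lborel) (barcode H)))
      in if i < length ls then ls ! i else 0)"

text \<open>Uniform closeness in \<open>[0, \<infinity>]\<close> is with respect to the extended distance, for which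
  \<open>\<infinity>\<close> is at distance \<open>0\<close> from itself and at infinite distance from every real number. On
  finite hierarchical clusterings the limit agrees with \<open>prominence_fin\<close>, because pruning
  by \<open>\<tau>\<close> shortens every bar by at most \<open>\<tau>\<close>.\<close>

definition is_prominence :: "(real \<Rightarrow> 'a set set) \<Rightarrow> (nat \<Rightarrow> ennreal) \<Rightarrow> bool" where
  "is_prominence H P \<longleftrightarrow>
     (\<forall>\<delta>>0. \<forall>\<^sub>F \<tau> in at_right (0::real). \<forall>i.
        prominence_fin (prune \<tau> H) i \<le> P i + ennreal \<delta> \<and>
        P i \<le> prominence_fin (prune \<tau> H) i + ennreal \<delta>)"

definition prominence :: "(real \<Rightarrow> 'a set set) \<Rightarrow> nat \<Rightarrow> ennreal" where
  "prominence H = (THE P. is_prominence H P)"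

definition gap :: "(real \<Rightarrow> 'a set set) \<Rightarrow> nat \<Rightarrow> ennreal set" where
  "gap H n = {prominence H n <..< prominence H (n - 1)}"

text \<open>The case distinction is needed because \<open>\<infinity> - \<infinity> = \<infinity>\<close> in \<open>ennreal\<close>, while the
  length of an empty gap is \<open>0\<close>.\<close>

definition gapsize :: "(real \<Rightarrow> 'a set set) \<Rightarrow> nat \<Rightarrow> ennreal" where
  "gapsize H n = (if gap H n = {} then 0 else prominence H (n - 1) - prominence H n)"


section \<open>Persistence-based flattening\<close>

text \<open>The midpoint of the gap is a real number only if the gap is bounded. For an unbounded gap
  (for instance, \<open>n = 1\<close> and a single infinite bar) any level in the gap gives \<open>n\<close> leaves, but
  there is no midpoint, and we prune at distance \<open>\<delta> > 0\<close> from the lower end of the gap; \<open>\<delta>\<close> is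
  irrelevant for bounded gaps. The definition is meaningful only if the gap is non-empty.\<close>

definition flattening_level :: "real \<Rightarrow> (real \<Rightarrow> 'a set set) \<Rightarrow> nat \<Rightarrow> real" where
  "flattening_level \<delta> H n =
     (if prominence H (n - 1) = \<infinity> then enn2real (prominence H n) + \<delta>
      else enn2real ((prominence H (n - 1) + prominence H n) / 2))"

definition PF :: "real \<Rightarrow> (real \<Rightarrow> 'a set set) \<Rightarrow> nat \<Rightarrow> 'a pcluster set" where
  "PF \<delta> H n = leaves (prune (flattening_level \<delta> H n) H)"

end

theory Submission
  imports Defs
begin

text \<open>A leaf of a hierarchical clustering is a maximal chain of clusters that contain at most one
  cluster of every earlier level. By the elder rule the leaves of \<open>H\<close> are in bijection with the
  bars of its barcode, and pruning by \<open>\<tau>\<close> intersects every bar with its translate by \<open>\<tau>\<close>.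
  Hence \<open>prominence H i\<close> is the supremum of the \<open>\<tau>\<close> for which \<open>prune \<tau> H\<close> has more than
  \<open>i\<close> leaves. An \<open>\<epsilon>\<close>-interleaving yields an injection from the leaves of \<open>prune (\<tau> + 2\<epsilon>) E\<close> to
  those of \<open>prune \<tau> H\<close>, so prominences differ by at most \<open>2\<epsilon>\<close> and so do the flattening levels.
  Therefore the two pruned clusterings are \<open>3\<epsilon>\<close>-interleaved. As the number of leaves is still
  \<open>n\<close> after pruning by a further \<open>6\<epsilon>\<close>, every leaf lives for at least \<open>6\<epsilon>\<close>; pushing an
  early cluster of a leaf across the interleaving and back then returns to the same leaf, which
  gives the matching. All comparisons take place on \<open>R\<close>, to which both clusterings are pulled back.\<close>

subsection \<open>Leaves\<close>

text \<open>A short leaf has no canonical partner: its cluster may arrive on the other side inside a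
  cluster that already holds several leaves. The return trip settles this only while it stays within
  the life of the leaf, hence the demand for length. The number 16 provides it: half the gap of H
  exceeds 8\<epsilon>, and moving both ends of the gap by up to 2\<epsilon> leaves more than
  6\<epsilon> above the level for E.

  The second obstacle is death. The extension of a persistent cluster jumps to the whole set once
  the cluster has ended, so matched leaves must also end at nearly the same time. A leaf ends
  because its branch meets another leaf; the partners of the two have then met at most 3\<epsilon>
  later, and injectivity of the matching makes that a genuine merger.

  H itself may have infinitely many classes and no leaf at all, so barcodes and leaf counts are
  taken only after pruning by a positive amount. Counts are the form in which prominence crosses the
  interleaving: they are insensitive to pullback, and no bars have to be matched.\<close>

definition leaf_point :: "(real \<Rightarrow> 'a set set) \<Rightarrow> real \<Rightarrow> 'a set \<Rightarrow> bool" where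
  "leaf_point G s B \<longleftrightarrow>
     B \<in> G s \<and> (\<forall>r\<le>s. \<forall>A\<in>G r. \<forall>A'\<in>G r. A \<subseteq> B \<longrightarrow> A' \<subseteq> B \<longrightarrow> A = A')"

text \<open>Not automatic: a clustering that keeps splitting as the level decreases has clusters
  without any leaf below them. Both the search for partners and the count of bars start from a leaf
  below a given cluster.\<close>

definition rooted :: "(real \<Rightarrow> 'a set set) \<Rightarrow> bool" where
  "rooted G \<longleftrightarrow> (\<forall>s. \<forall>B\<in>G s. \<exists>r\<le>s. \<exists>A\<subseteq>B. leaf_point G r A)"

text \<open>By \<open>leaf_points_equiv_iff\<close>, overlap decides whether two leaf points are
  equivalent, so for a leaf point \<open>B\<close> this is its class, whatever the level of
  \<open>B\<close>.\<close>

definition leaf_class :: "(real \<Rightarrow> 'a set set) \<Rightarrow> 'a set \<Rightarrow> 'a pcluster" where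
  "leaf_class G B = {(r, A). leaf_point G r A \<and> A \<inter> B \<noteq> {}}"

section \<open>Nesting of clusters across levels\<close>

locale hc =
  fixes X :: "'a set" and G :: "real \<Rightarrow> 'a set set"
  assumes hier: "hier_clustering X UNIV G"
begin

lemma nonempty: "A \<in> G r \<Longrightarrow> A \<noteq> {}"
  using hier by (auto simp: hier_clustering_def clustering_def)

lemma subset_X: "A \<in> G r \<Longrightarrow> A \<subseteq> X"
  using hier by (auto simp: hier_clustering_def clustering_def)

lemma same_level: "A \<in> G r \<Longrightarrow> B \<in> G r \<Longrightarrow> A \<inter> B \<noteq> {} \<Longrightarrow> A = B"
  using hier by (auto simp: hier_clustering_def clustering_def pairwise_def disjnt_def)

lemma up: "A \<in> G r \<Longrightarrow> r \<le> s \<Longrightarrow> \<exists>B\<in>G s. A \<subseteq> B"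
  using hier by (auto simp: hier_clustering_def monotone_on_def refines_def)

lemma overlap:
  assumes "A \<in> G r" "B \<in> G s" "r \<le> s" "A \<inter> B \<noteq> {}"
  shows "A \<subseteq> B"
proof -
  obtain C where C: "C \<in> G s" "A \<subseteq> C" using up assms by blast
  then have "C \<inter> B \<noteq> {}" using assms by blast
  then show ?thesis using same_level C assms by blast
qed

lemma overlap_cases:
  assumes "A \<in> G r" "B \<in> G s" "A \<inter> B \<noteq> {}"
  shows "r \<le> s \<and> A \<subseteq> B \<or> s \<le> r \<and> B \<subseteq> A"
proof (cases "r \<le> s")
  case False
  then have "B \<subseteq> A" using overlap[of B s A r] assms by (simp add: Int_commute)
  then show ?thesis using False by simp
qed (use overlap assms in auto)

lemma hc_map_image:
  assumes "r \<le> s"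
  shows "hc_map G r s ` G r = {B \<in> G s. \<exists>A\<in>G r. A \<subseteq> B}"
proof -
  have eq: "hc_map G r s A = B" if "A \<in> G r" "B \<in> G s" "A \<subseteq> B" for A B
    unfolding hc_map_def
  proof (rule the_equality)
    show "D = B" if "D \<in> G s \<and> A \<subseteq> D" for D
      using that \<open>B \<in> G s\<close> \<open>A \<subseteq> B\<close> same_level[of D s B] nonempty[OF \<open>A \<in> G r\<close>] by blast
  qed (use that in auto)
  show ?thesis
  proof (intro equalityI subsetI)
    fix B assume "B \<in> hc_map G r s ` G r"
    then obtain A where A: "A \<in> G r" "B = hc_map G r s A" by blast
    obtain C where C: "C \<in> G s" "A \<subseteq> C" using up A assms by blast
    with eq A have "B = C" by blast
    with A C show "B \<in> {B \<in> G s. \<exists>A\<in>G r. A \<subseteq> B}" by blast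
  next
    fix B assume "B \<in> {B \<in> G s. \<exists>A\<in>G r. A \<subseteq> B}"
    then show "B \<in> hc_map G r s ` G r" using eq by force
  qed
qed

text \<open>At each intermediate level a cluster inside \<open>B\<close> always exists, namely the
  image of \<open>A\<close>. Uniqueness therefore says that every candidate coincides with that
  image, that is, contains \<open>A\<close>.\<close>

lemma pc_rel_iff:
  "((r, A), (s, B)) \<in> pc_rel G \<longleftrightarrow>
     r \<le> s \<and> A \<in> G r \<and> B \<in> G s \<and> A \<subseteq> B \<and>
     (\<forall>t. r \<le> t \<longrightarrow> t \<le> s \<longrightarrow> (\<forall>D\<in>G t. D \<subseteq> B \<longrightarrow> A \<subseteq> D))"
  (is "?l \<longleftrightarrow> ?r")
proof
  assume l: ?l
  then have *: "r \<le> s" "A \<in> G r" "B \<in> G s" "A \<subseteq> B"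
    and uniq: "\<And>t. r \<le> t \<Longrightarrow> t \<le> s \<Longrightarrow> \<exists>!C. C \<in> G t \<and> C \<subseteq> B"
    by (auto simp: pc_rel_def)
  have "A \<subseteq> D" if t: "r \<le> t" "t \<le> s" and D: "D \<in> G t" "D \<subseteq> B" for t D
  proof -
    obtain C where C: "C \<in> G t" "A \<subseteq> C" using up * t by blast
    have "C \<inter> B \<noteq> {}" using C * nonempty[of A r] by blast
    then have "C \<subseteq> B" using overlap C * t by blast
    then have "C = D" using uniq[OF t] C D by blast
    with C show ?thesis by blast
  qed
  with * show ?r by blast
next
  assume r: ?r
  then have A: "A \<in> G r" "B \<in> G s" "A \<subseteq> B" by auto
  have "\<exists>!C. C \<in> G t \<and> C \<subseteq> B" if t: "r \<le> t" "t \<le> s" for t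
  proof -
    obtain C where C: "C \<in> G t" "A \<subseteq> C" using up A t by blast
    have "C \<inter> B \<noteq> {}" using C A nonempty[of A r] by blast
    then have "C \<subseteq> B" using overlap C A t by blast
    moreover have "D = C" if "D \<in> G t" "D \<subseteq> B" for D
    proof -
      have "A \<subseteq> D" using r t that by blast
      then show ?thesis using same_level[of D t C] that C nonempty[OF A(1)] by blast
    qed
    ultimately show ?thesis using C by blast
  qed
  with r show ?l by (auto simp: pc_rel_def)
qed

lemma pc_relD:
  assumes "((r, A), (s, B)) \<in> pc_rel G"
  shows "r \<le> s" "A \<in> G r" "B \<in> G s" "A \<subseteq> B"
    "\<And>t D. r \<le> t \<Longrightarrow> t \<le> s \<Longrightarrow> D \<in> G t \<Longrightarrow> D \<subseteq> B \<Longrightarrow> A \<subseteq> D"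
  using assms unfolding pc_rel_iff by blast+

abbreviation pc_equiv where "pc_equiv \<equiv> pc_rel G \<union> (pc_rel G)\<inverse>"

text \<open>Only a cluster \<open>D\<close> of a level below \<open>s\<close> needs an argument: its
  image at level \<open>s\<close> lies in \<open>C\<close>, hence contains \<open>B\<close>, hence
  is \<open>B\<close>, and \<open>D\<close> falls under the first relation.\<close>

lemma pc_rel_trans:
  assumes "((r, A), (s, B)) \<in> pc_rel G" "((s, B), (u, C)) \<in> pc_rel G"
  shows "((r, A), (u, C)) \<in> pc_rel G"
proof -
  have 1: "r \<le> s" "A \<in> G r" "B \<in> G s" "A \<subseteq> B" "s \<le> u" "C \<in> G u" "B \<subseteq> C"
    and 2: "\<And>t D. r \<le> t \<Longrightarrow> t \<le> s \<Longrightarrow> D \<in> G t \<Longrightarrow> D \<subseteq> B \<Longrightarrow> A \<subseteq> D"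
    and 3: "\<And>t D. s \<le> t \<Longrightarrow> t \<le> u \<Longrightarrow> D \<in> G t \<Longrightarrow> D \<subseteq> C \<Longrightarrow> B \<subseteq> D"
    using assms by (auto simp: pc_rel_iff)
  have "A \<subseteq> D" if t: "r \<le> t" "t \<le> u" and D: "D \<in> G t" "D \<subseteq> C" for t D
  proof (cases "s \<le> t")
    case True
    then show ?thesis using 3[of t D] t D 1 by blast
  next
    case False
    then have "t \<le> s" by simp
    then obtain D' where D': "D' \<in> G s" "D \<subseteq> D'" using up[OF D(1)] by blast
    have "D' \<inter> C \<noteq> {}" using D' D nonempty[of D t] by blast
    then have "D' \<subseteq> C" using overlap[OF D'(1)] 1 by blast
    then have "B \<subseteq> D'" using 3[of s D'] D' 1 by blast
    then have "D' = B" using same_level[OF D'(1) 1(3)] nonempty[OF 1(3)] by blast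
    then show ?thesis using 2[of t D] D D' t False by simp
  qed
  then show ?thesis using 1 by (auto simp: pc_rel_iff)
qed

text \<open>With \<open>pc_rel_common_lower\<close> and \<open>pc_rel_trans\<close> this covers all
  orientations of two consecutive steps, which makes the symmetric closure transitive.\<close>

lemma pc_rel_common_upper:
  assumes "((r, A), (s, B)) \<in> pc_rel G" "((u, C), (s, B)) \<in> pc_rel G" "r \<le> u"
  shows "((r, A), (u, C)) \<in> pc_rel G"
proof -
  have 1: "u \<le> s" "A \<in> G r" "B \<in> G s" "C \<in> G u" "C \<subseteq> B"
    and 2: "\<And>t D. r \<le> t \<Longrightarrow> t \<le> s \<Longrightarrow> D \<in> G t \<Longrightarrow> D \<subseteq> B \<Longrightarrow> A \<subseteq> D"
    using assms by (auto simp: pc_rel_iff)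
  have "A \<subseteq> C" using 2[of u C] 1 assms by auto
  moreover have "A \<subseteq> D" if "r \<le> t" "t \<le> u" "D \<in> G t" "D \<subseteq> C" for t D
    using 2[of t D] that 1 by simp
  ultimately show ?thesis using 1(1,2,4) assms(3) unfolding pc_rel_iff by blast
qed

lemma pc_rel_common_lower:
  assumes "((s, B), (r, A)) \<in> pc_rel G" "((s, B), (u, C)) \<in> pc_rel G" "r \<le> u"
  shows "((r, A), (u, C)) \<in> pc_rel G"
proof -
  have 1: "s \<le> r" "A \<in> G r" "B \<in> G s" "C \<in> G u" "B \<subseteq> A" "B \<subseteq> C"
    and 2: "\<And>t D. s \<le> t \<Longrightarrow> t \<le> u \<Longrightarrow> D \<in> G t \<Longrightarrow> D \<subseteq> C \<Longrightarrow> B \<subseteq> D"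
    using assms by (auto simp: pc_rel_iff)
  have ne: "B \<noteq> {}" using nonempty 1 by blast
  have "A \<subseteq> C" using overlap[OF 1(2) 1(4) assms(3)] 1 ne by blast
  moreover have "A \<subseteq> D" if "r \<le> t" "t \<le> u" "D \<in> G t" "D \<subseteq> C" for t D
  proof -
    have "B \<subseteq> D" using 2[of t D] that 1 by auto
    then show ?thesis using overlap[OF 1(2) that(3) that(1)] 1 ne by blast
  qed
  ultimately show ?thesis using 1 assms by (auto simp: pc_rel_iff)
qed

lemma equiv_pc: "equiv (SIGMA r:UNIV. G r) pc_equiv"
proof (rule equivI)
  show "pc_equiv \<subseteq> (SIGMA r:UNIV. G r) \<times> (SIGMA r:UNIV. G r)"
    by (auto simp: pc_rel_def)
  show "refl_on (SIGMA r:UNIV. G r) pc_equiv"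
  proof (rule refl_onI)
    fix p assume "p \<in> (SIGMA r:UNIV. G r)"
    then obtain r A where p: "p = (r, A)" and A: "A \<in> G r" by auto
    have "((r, A), (r, A)) \<in> pc_rel G"
      unfolding pc_rel_iff
    proof (intro conjI allI impI ballI)
      fix t D assume "r \<le> t" "t \<le> r" "D \<in> G t" "D \<subseteq> A"
      then show "A \<subseteq> D" using same_level[of D r A] A nonempty[of D r] by auto
    qed (use A in auto)
    then show "(p, p) \<in> pc_equiv" using p by simp
  qed
  show "sym pc_equiv" by (auto simp: sym_def)
  show "trans pc_equiv"
  proof (rule transI)
    fix p q v :: "real \<times> 'a set"
    obtain r A s B u C where pqv: "p = (r, A)" "q = (s, B)" "v = (u, C)" by (metis surj_pair)
    assume "(p, q) \<in> pc_equiv" "(q, v) \<in> pc_equiv"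
    then have "(((r, A), (s, B)) \<in> pc_rel G \<or> ((s, B), (r, A)) \<in> pc_rel G) \<and>
        (((s, B), (u, C)) \<in> pc_rel G \<or> ((u, C), (s, B)) \<in> pc_rel G)"
      using pqv by blast
    then have "((r, A), (u, C)) \<in> pc_rel G \<or> ((u, C), (r, A)) \<in> pc_rel G"
      using pc_rel_trans pc_rel_common_upper pc_rel_common_lower linear[of r u] by metis
    then show "(p, v) \<in> pc_equiv" using pqv by blast
  qed
qed

section \<open>Classes of persistent clusters as chains\<close>

lemma pc_eq:
  assumes "c \<in> PC G" "d \<in> PC G" "p \<in> c" "p \<in> d"
  shows "c = d"
  using quotient_disj[OF equiv_pc] assms unfolding PC_def by blast

lemma pc_related:
  assumes "c \<in> PC G" "p \<in> c" "q \<in> c"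
  shows "(p, q) \<in> pc_equiv"
  using quotient_eq_iff[OF equiv_pc, of c c p q] assms unfolding PC_def by blast

lemma pc_closed:
  assumes "c \<in> PC G" "p \<in> c" "(p, q) \<in> pc_equiv"
  shows "q \<in> c"
  using in_quotient_imp_closed[OF equiv_pc] assms unfolding PC_def by blast

lemma pc_exists:
  assumes "A \<in> G r"
  shows "\<exists>c\<in>PC G. (r, A) \<in> c"
proof -
  have "(r, A) \<in> (SIGMA r:UNIV. G r)" using assms by simp
  then show ?thesis
    unfolding PC_def by (meson equiv_class_self[OF equiv_pc] quotientI)
qed

lemma pc_nonempty: "c \<in> PC G \<Longrightarrow> \<exists>r A. (r, A) \<in> c"
  using in_quotient_imp_non_empty[OF equiv_pc] unfolding PC_def by fast

lemma pc_level: "c \<in> PC G \<Longrightarrow> (r, A) \<in> c \<Longrightarrow> A \<in> G r"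
  using in_quotient_imp_subset[OF equiv_pc] unfolding PC_def by blast

lemma pc_comparable:
  assumes "c \<in> PC G" "(r, A) \<in> c" "(s, B) \<in> c" "r \<le> s"
  shows "((r, A), (s, B)) \<in> pc_rel G"
proof -
  have "((r, A), (s, B)) \<in> pc_equiv" using pc_related assms by blast
  then consider "((r, A), (s, B)) \<in> pc_rel G" | "((s, B), (r, A)) \<in> pc_rel G" by blast
  then show ?thesis
  proof cases
    case 2
    then have *: "s = r" "B \<subseteq> A" "B \<in> G r" "A \<in> G r" using assms by (auto simp: pc_rel_iff)
    then have "A = B" using same_level[of A r B] nonempty[of B r] by blast
    with 2 * show ?thesis by simp
  qed
qed

lemma pc_functional: "c \<in> PC G \<Longrightarrow> (r, A) \<in> c \<Longrightarrow> (r, B) \<in> c \<Longrightarrow> A = B"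
  using pc_comparable[of c r A r B] pc_comparable[of c r B r A] by (auto simp: pc_rel_iff)

lemma pc_at_eq: "c \<in> PC G \<Longrightarrow> (r, A) \<in> c \<Longrightarrow> pc_at c r = A"
  unfolding pc_at_def by (metis pc_functional the_equality)

lemma underlying_eq: "c \<in> PC G \<Longrightarrow> underlying c = (\<Union>(r, A)\<in>c. A)"
  unfolding underlying_def life_def by (force simp: pc_at_eq)

section \<open>Leaf points and minimal classes\<close>

lemma leaf_point_level: "leaf_point G r A \<Longrightarrow> A \<in> G r"
  by (simp add: leaf_point_def)

lemma leaf_pointD:
  "leaf_point G s B \<Longrightarrow> r \<le> s \<Longrightarrow> A \<in> G r \<Longrightarrow> A' \<in> G r \<Longrightarrow> A \<subseteq> B \<Longrightarrow> A' \<subseteq> B \<Longrightarrow> A = A'"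
  by (auto simp: leaf_point_def)

lemma leaf_point_below:
  assumes "leaf_point G s B" "A \<in> G r" "r \<le> s" "A \<subseteq> B"
  shows "leaf_point G r A"
  unfolding leaf_point_def
proof (intro conjI allI impI ballI assms(2))
  fix t C C' assume "t \<le> r" "C \<in> G t" "C' \<in> G t" "C \<subseteq> A" "C' \<subseteq> A"
  then show "C = C'" using leaf_pointD[OF assms(1), of t C C'] assms(3,4) by simp
qed

lemma leaf_point_pc_rel:
  assumes "leaf_point G s B" "A \<in> G r" "r \<le> s" "A \<subseteq> B"
  shows "((r, A), (s, B)) \<in> pc_rel G"
  unfolding pc_rel_iff
proof (intro conjI allI impI ballI)
  fix t D assume t: "r \<le> t" "t \<le> s" and D: "D \<in> G t" "D \<subseteq> B"
  obtain C where C: "C \<in> G t" "A \<subseteq> C" using up assms t by blast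
  have "C \<subseteq> B" using overlap[OF C(1) leaf_point_level[OF assms(1)] t(2)] nonempty[OF assms(2)] C assms
    by blast
  then have "C = D" using leaf_pointD[OF assms(1) t(2) C(1) D(1)] D by blast
  then show "A \<subseteq> D" using C by simp
qed (use assms leaf_point_level in auto)

text \<open>A cluster inside \<open>B\<close> of a level up to \<open>r\<close> lies in
  \<open>A\<close>: its image at level \<open>r\<close> lies in \<open>B\<close>, so it contains
  \<open>A\<close> and equals it. Clusters inside \<open>B\<close> of later levels contain
  \<open>A\<close>, so no two of them are disjoint.\<close>

lemma leaf_point_above:
  assumes "leaf_point G r A" "((r, A), (s, B)) \<in> pc_rel G"
  shows "leaf_point G s B"
  unfolding leaf_point_def
proof (intro conjI allI impI ballI)
  have 1: "r \<le> s" "A \<in> G r" "B \<in> G s" "A \<subseteq> B"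
    and 2: "\<And>t D. r \<le> t \<Longrightarrow> t \<le> s \<Longrightarrow> D \<in> G t \<Longrightarrow> D \<subseteq> B \<Longrightarrow> A \<subseteq> D"
    using assms by (auto simp: pc_rel_iff)
  have *: "C \<subseteq> A" if C: "C \<in> G t" "C \<subseteq> B" "t \<le> r" for C t
  proof -
    obtain C' where C': "C' \<in> G r" "C \<subseteq> C'" using up[OF C(1,3)] by blast
    then have "C' \<subseteq> B" using overlap[OF C'(1) 1(3,1)] nonempty[OF C(1)] C C' by blast
    then have "A \<subseteq> C'" using 2[of r C'] 1 C' by simp
    then show ?thesis using same_level[OF C'(1) 1(2)] nonempty[OF 1(2)] C' by blast
  qed
  show "B \<in> G s" by fact
  fix t C C' assume t: "t \<le> s" and C: "C \<in> G t" "C' \<in> G t" "C \<subseteq> B" "C' \<subseteq> B"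
  show "C = C'"
  proof (cases "t \<le> r")
    case True
    then show ?thesis using leaf_pointD[OF assms(1) True C(1,2)] * C by blast
  next
    case False
    then have "A \<subseteq> C" "A \<subseteq> C'" using 2[of t] C t by auto
    then show ?thesis using same_level[OF C(1,2)] nonempty[OF 1(2)] by blast
  qed
qed

lemma leaf_point_equiv:
  assumes "leaf_point G r A" "((r, A), (s, B)) \<in> pc_equiv"
  shows "leaf_point G s B"
  using assms leaf_point_above[of r A s B] leaf_point_below[OF assms(1), of B s]
  by (auto simp: pc_rel_iff)

text \<open>Overlap makes two leaf points nested, and a cluster inside a leaf point is always
  related to it. Membership in a leaf is tested below by overlap alone.\<close>

lemma leaf_points_equiv_iff:
  assumes "leaf_point G r A" "leaf_point G s B"
  shows "((r, A), (s, B)) \<in> pc_equiv \<longleftrightarrow> A \<inter> B \<noteq> {}"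
proof
  assume "((r, A), (s, B)) \<in> pc_equiv"
  moreover have "A \<noteq> {}" "B \<noteq> {}" using assms nonempty leaf_point_level by blast+
  ultimately show "A \<inter> B \<noteq> {}" by (auto simp: pc_rel_iff)
next
  assume "A \<inter> B \<noteq> {}"
  then consider "r \<le> s" "A \<subseteq> B" | "s \<le> r" "B \<subseteq> A"
    using overlap_cases assms leaf_point_level by blast
  then show "((r, A), (s, B)) \<in> pc_equiv"
    using leaf_point_pc_rel assms leaf_point_level by cases auto
qed

lemma leaf_class_pc:
  assumes "c \<in> PC G" "(s, B) \<in> c" "leaf_point G s B"
  shows "c = leaf_class G B"
proof (intro equalityI subsetI; clarify)
  fix r A assume "(r, A) \<in> c"
  then have *: "((s, B), (r, A)) \<in> pc_equiv" using pc_related assms by blast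
  then have "leaf_point G r A" using leaf_point_equiv assms by blast
  then show "(r, A) \<in> leaf_class G B"
    using * leaf_points_equiv_iff assms by (auto simp: leaf_class_def Int_commute)
next
  fix r A assume "(r, A) \<in> leaf_class G B"
  then have "leaf_point G r A" "B \<inter> A \<noteq> {}" by (auto simp: leaf_class_def)
  then have "((s, B), (r, A)) \<in> pc_equiv" using leaf_points_equiv_iff assms by blast
  then show "(r, A) \<in> c" using pc_closed assms by blast
qed

text \<open>If \<open>B\<close> contained two clusters \<open>A\<close>, \<open>A'\<close> of one
  level, the class of \<open>A\<close> would lie entirely inside \<open>B\<close> and hence below
  \<open>c\<close>. Minimality would put \<open>A\<close> and \<open>B\<close> into one class,
  although \<open>A'\<close> is inside \<open>B\<close> as well.\<close>

lemma leaves_imp_leaf_point: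
  assumes c: "c \<in> leaves G" and "(s, B) \<in> c"
  shows "leaf_point G s B"
proof (rule ccontr)
  have cPC: "c \<in> PC G" using c by (simp add: leaves_def)
  have B: "B \<in> G s" using pc_level cPC assms by blast
  assume "\<not> leaf_point G s B"
  then obtain r A A' where r: "r \<le> s" "A \<in> G r" "A' \<in> G r" "A \<subseteq> B" "A' \<subseteq> B" "A \<noteq> A'"
    using B by (auto simp: leaf_point_def)
  have nA: "\<not> A \<subseteq> A'" using same_level[OF r(2,3)] nonempty[OF r(2)] r(6) by blast
  obtain d where d: "d \<in> PC G" "(r, A) \<in> d" using pc_exists[OF r(2)] by blast
  \<comment> \<open>The class \<open>d\<close> cannot grow past \<open>B\<close>: a member of level
    at least \<open>s\<close> would contain \<open>B\<close>, hence \<open>A'\<close>, and its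
    relation to \<open>A\<close> would force \<open>A \<subseteq> A'\<close>.\<close>
  have "D \<subseteq> B" if D: "(t, D) \<in> d" for t D
  proof -
    have Dt: "D \<in> G t" using pc_level[OF d(1) D] .
    consider "t \<le> r" | "r \<le> t" "t \<le> s" | "r \<le> t" "s \<le> t" by linarith
    then show ?thesis
    proof cases
      case 1
      then show ?thesis using pc_relD(4)[OF pc_comparable[OF d(1) D d(2)]] r(4) by blast
    next
      case 2
      then have "A \<subseteq> D" using pc_relD(4)[OF pc_comparable[OF d(1) d(2) D]] by blast
      then show ?thesis using overlap[OF Dt B] 2 r nonempty[OF r(2)] by blast
    next
      case 3
      have rel: "((r, A), (t, D)) \<in> pc_rel G" using pc_comparable[OF d(1) d(2) D] 3 by blast
      have "A \<subseteq> D" using pc_relD(4)[OF rel] .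
      then have "B \<subseteq> D" using overlap[OF B Dt] 3 r nonempty[OF r(2)] by blast
      then have "A \<subseteq> A'" using pc_relD(5)[OF rel order_refl 3(1) r(3)] r(5) by blast
      with nA show ?thesis by blast
    qed
  qed
  then have "underlying d \<subseteq> underlying c"
    using assms(2) unfolding underlying_eq[OF d(1)] underlying_eq[OF cPC] by fast
  then have "d = c" using c d by (auto simp: leaves_def pc_le_def)
  then have "((r, A), (s, B)) \<in> pc_rel G" using pc_comparable[OF d(1) d(2) _ r(1)] assms(2) by blast
  then show False using pc_relD(5)[OF _ order_refl r(1,3,5)] nA by blast
qed

text \<open>A cluster \<open>A\<close> of \<open>d\<close> is covered by clusters of
  \<open>c\<close>. Either one of them at a level not below that of \<open>A\<close> meets
  \<open>A\<close>, and then contains it and is related to it; or all those meeting \<open>A\<close>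
  are strictly earlier, and then \<open>A\<close> extends the chain \<open>c\<close>
  upwards.\<close>

lemma leaf_point_imp_leaves:
  assumes c: "c \<in> PC G" and B: "(s, B) \<in> c" "leaf_point G s B"
  shows "c \<in> leaves G"
  unfolding leaves_def pc_le_def
proof (intro CollectI conjI ballI impI c)
  fix d assume d: "d \<in> PC G" and sub: "underlying d \<subseteq> underlying c"
  have lp: "leaf_point G t D" if "(t, D) \<in> c" for t D
    using leaf_point_equiv[OF B(2)] pc_related[OF c B(1) that] by blast
  obtain r A where A: "(r, A) \<in> d" using pc_nonempty[OF d] by blast
  have Ar: "A \<in> G r" using pc_level[OF d A] .
  have cov: "\<exists>t D. (t, D) \<in> c \<and> x \<in> D" if "x \<in> A" for x
  proof -
    have "x \<in> underlying d" using A that underlying_eq[OF d] by blast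
    then show ?thesis using sub underlying_eq[OF c] by blast
  qed
  show "d = c"
  proof (cases "\<exists>t D. (t, D) \<in> c \<and> r \<le> t \<and> A \<inter> D \<noteq> {}")
    case True
    then obtain t D where D: "(t, D) \<in> c" "r \<le> t" "A \<inter> D \<noteq> {}" by blast
    then have "A \<subseteq> D" using overlap[OF Ar pc_level[OF c]] by blast
    then have "((r, A), (t, D)) \<in> pc_equiv" using leaf_point_pc_rel[OF lp[OF D(1)] Ar D(2)] by blast
    then have "(t, D) \<in> d" using pc_closed[OF d A] by blast
    then show ?thesis using pc_eq[OF d c _ D(1)] by blast
  next
    case False
    then have below: "t < r" if "(t, D) \<in> c" "x \<in> D" "x \<in> A" for t D x
      using that by (meson disjoint_iff not_le)
    obtain x where "x \<in> A" using nonempty[OF Ar] by blast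
    then obtain t D where D: "(t, D) \<in> c" "x \<in> D" using cov by blast
    then have tr: "t < r" using below \<open>x \<in> A\<close> by blast
    have Dt: "D \<in> G t" using pc_level[OF c D(1)] .
    have DA: "D \<subseteq> A" using overlap[OF Dt Ar] tr D \<open>x \<in> A\<close> by force
    \<comment> \<open>Each such \<open>F\<close> shares a point with some \<open>D'\<close> of
      \<open>c\<close>, since \<open>c\<close> covers \<open>A\<close>. Wherever the level of
      \<open>D'\<close> lies relative to \<open>t\<close> and \<open>u\<close>, the chain
      \<open>c\<close> carries \<open>D\<close> into \<open>F\<close>.\<close>
    have "D \<subseteq> F" if u: "t \<le> u" "u \<le> r" and F: "F \<in> G u" "F \<subseteq> A" for u F
    proof -
      obtain y where y: "y \<in> F" using nonempty[OF F(1)] by blast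
      then obtain t' D' where D': "(t', D') \<in> c" "y \<in> D'" using cov F by blast
      have D't: "D' \<in> G t'" using pc_level[OF c D'(1)] .
      consider "t' \<le> t" | "t \<le> t'" "t' \<le> u" | "t \<le> t'" "u \<le> t'" by linarith
      then show ?thesis
      proof cases
        case 1
        then have "D' \<subseteq> D" using pc_relD(4)[OF pc_comparable[OF c D'(1) D(1)]] by blast
        then show ?thesis using overlap[OF Dt F(1)] u y D' by blast
      next
        case 2
        then have "D \<subseteq> D'" using pc_relD(4)[OF pc_comparable[OF c D(1) D'(1)]] by blast
        moreover have "D' \<subseteq> F" using overlap[OF D't F(1)] 2 y D' by blast
        ultimately show ?thesis by blast
      next
        case 3
        then have "F \<subseteq> D'" using overlap[OF F(1) D't] y D' by blast
        then show ?thesis using pc_relD(5)[OF pc_comparable[OF c D(1) D'(1) 3(1)] u(1) 3(2) F(1)] by blast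
      qed
    qed
    then have "((t, D), (r, A)) \<in> pc_equiv" using tr Dt Ar DA unfolding Un_iff pc_rel_iff by simp
    then have "(r, A) \<in> c" using pc_closed[OF c D(1)] by blast
    then show ?thesis using pc_eq[OF d c A] by blast
  qed
qed

lemma leaves_eq: "leaves G = {leaf_class G B | s B. leaf_point G s B}"
proof (intro equalityI subsetI)
  fix c assume c: "c \<in> leaves G"
  then have cPC: "c \<in> PC G" by (simp add: leaves_def)
  then obtain s B where B: "(s, B) \<in> c" using pc_nonempty[OF cPC] by blast
  have "leaf_point G s B" using leaves_imp_leaf_point[OF c B] .
  then show "c \<in> {leaf_class G B | s B. leaf_point G s B}" using leaf_class_pc[OF cPC B] by blast
next
  fix c assume "c \<in> {leaf_class G B | s B. leaf_point G s B}"
  then obtain s B where B: "leaf_point G s B" "c = leaf_class G B" by blast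
  obtain d where d: "d \<in> PC G" "(s, B) \<in> d" using pc_exists[OF leaf_point_level[OF B(1)]] by blast
  have "d \<in> leaves G" using leaf_point_imp_leaves[OF d B(1)] .
  moreover have "d = c" using leaf_class_pc[OF d B(1)] B(2) by simp
  ultimately show "c \<in> leaves G" by simp
qed

text \<open>Descend from \<open>B\<close> to one of two distinct clusters \<open>A\<close>,
  \<open>A'\<close> of the same level. The class of \<open>A'\<close> has a member below
  \<open>B\<close> but none below \<open>A\<close>, since members of one class are nested; so the
  finite number of classes seen from below drops.\<close>

lemma rooted_if_finite:
  assumes "finite (PC G)"
  shows "rooted G"
proof -
  define below where "below s B = {c \<in> PC G. \<exists>r A. (r, A) \<in> c \<and> r \<le> s \<and> A \<subseteq> B}" for s B
  have fin: "finite (below s B)" for s B using assms by (simp add: below_def)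
  have "\<exists>r\<le>s. \<exists>A\<subseteq>B. leaf_point G r A" if "B \<in> G s" for s B
    using that
  proof (induction "card (below s B)" arbitrary: s B rule: less_induct)
    case less
    show ?case
    proof (cases "leaf_point G s B")
      case False
      then obtain r A A' where r: "r \<le> s" "A \<in> G r" "A' \<in> G r" "A \<subseteq> B" "A' \<subseteq> B" "A \<noteq> A'"
        using less.prems by (auto simp: leaf_point_def)
      obtain c where c: "c \<in> PC G" "(r, A') \<in> c" using pc_exists[OF r(3)] by blast
      have "c \<notin> below r A"
      proof
        assume "c \<in> below r A"
        then obtain t D where D: "(t, D) \<in> c" "t \<le> r" "D \<subseteq> A" by (auto simp: below_def)
        have "D \<subseteq> A'" using pc_relD(4)[OF pc_comparable[OF c(1) D(1) c(2) D(2)]] .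
        moreover have "D \<noteq> {}" using nonempty[OF pc_level[OF c(1) D(1)]] .
        ultimately show False using same_level[OF r(2,3)] r(6) D(3) by (metis Int_greatest subset_empty)
      qed
      moreover have "c \<in> below s B" using c r by (auto simp: below_def)
      moreover have "below r A \<subseteq> below s B" 
      proof
        fix e assume "e \<in> below r A"
        then obtain t D where D: "e \<in> PC G" "(t, D) \<in> e" "t \<le> r" "D \<subseteq> A" by (auto simp: below_def)
        moreover have "t \<le> s" "D \<subseteq> B" using D(3,4) r(1,4) by auto
        ultimately show "e \<in> below s B" by (auto simp: below_def)
      qed
      ultimately have "card (below r A) < card (below s B)" using fin by (intro psubset_card_mono) auto
      from less.hyps[OF this r(2)] show ?thesis using r by (meson order_trans)
    qed blast
  qed
  then show ?thesis by (simp add: rooted_def)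
qed

section \<open>Overlap, convexity and existence of leaves\<close>

lemma leaf_in_PC: "c \<in> leaves G \<Longrightarrow> c \<in> PC G"
  by (simp add: leaves_def)

lemma leaf_level: "c \<in> leaves G \<Longrightarrow> (r, A) \<in> c \<Longrightarrow> A \<in> G r"
  using pc_level leaf_in_PC by blast

lemma leaf_nonempty: "c \<in> leaves G \<Longrightarrow> \<exists>r A. (r, A) \<in> c"
  using pc_nonempty leaf_in_PC by blast

lemma leaf_at: "c \<in> leaves G \<Longrightarrow> (r, A) \<in> c \<Longrightarrow> pc_at c r = A"
  using pc_at_eq leaf_in_PC by blast

lemma leaf_overlap:
  assumes "c \<in> leaves G" "(r, A) \<in> c" "(s, B) \<in> c"
  shows "A \<inter> B \<noteq> {}"
  using pc_related[OF leaf_in_PC[OF assms(1)] assms(2,3)]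
    leaf_points_equiv_iff[OF leaves_imp_leaf_point[OF assms(1,2)] leaves_imp_leaf_point[OF assms(1,3)]]
  by blast

lemma leaf_mono:
  assumes "c \<in> leaves G" "(r, A) \<in> c" "(s, B) \<in> c" "r \<le> s"
  shows "A \<subseteq> B"
  using overlap[OF leaf_level[OF assms(1,2)] leaf_level[OF assms(1,3)] assms(4) leaf_overlap[OF assms(1-3)]] .

lemma leaf_mem:
  assumes "c \<in> leaves G" "(r, A) \<in> c" "leaf_point G s B" "A \<inter> B \<noteq> {}"
  shows "(s, B) \<in> c"
  using pc_closed[OF leaf_in_PC[OF assms(1)] assms(2)]
    leaf_points_equiv_iff[OF leaves_imp_leaf_point[OF assms(1,2)] assms(3)] assms(4) by blast

lemma leaf_eq:
  assumes "c \<in> leaves G" "d \<in> leaves G" "(r, A) \<in> c" "(s, B) \<in> d" "A \<inter> B \<noteq> {}"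
  shows "c = d"
proof -
  have "(s, B) \<in> c" using leaf_mem[OF assms(1,3) leaves_imp_leaf_point[OF assms(2,4)] assms(5)] .
  then show ?thesis using pc_eq[OF leaf_in_PC[OF assms(1)] leaf_in_PC[OF assms(2)] _ assms(4)] by blast
qed

lemma leaf_down:
  assumes "c \<in> leaves G" "(s, B) \<in> c" "A \<in> G r" "r \<le> s" "A \<inter> B \<noteq> {}"
  shows "(r, A) \<in> c"
proof -
  have "A \<subseteq> B" using overlap[OF assms(3) leaf_level[OF assms(1,2)] assms(4,5)] .
  then have "leaf_point G r A"
    using leaf_point_below[OF leaves_imp_leaf_point[OF assms(1,2)] assms(3,4)] by blast
  then show ?thesis using leaf_mem[OF assms(1,2)] assms(5) by blast
qed

lemma leaf_convex:
  assumes "c \<in> leaves G" "(r, A) \<in> c" "(s, B) \<in> c" "r \<le> t" "t \<le> s"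
  shows "\<exists>D. (t, D) \<in> c"
proof -
  obtain D where D: "D \<in> G t" "A \<subseteq> D" using up[OF leaf_level[OF assms(1,2)] assms(4)] by blast
  have "D \<inter> B \<noteq> {}" using leaf_overlap[OF assms(1-3)] D by blast
  then show ?thesis using leaf_down[OF assms(1,3) D(1) assms(5)] by blast
qed

lemma leaf_exists:
  assumes "leaf_point G r A"
  shows "\<exists>c\<in>leaves G. (r, A) \<in> c"
proof -
  obtain c where c: "c \<in> PC G" "(r, A) \<in> c" using pc_exists[OF leaf_point_level[OF assms]] by blast
  then show ?thesis using leaf_point_imp_leaves[OF c assms] by blast
qed

lemma leaf_below:
  assumes "rooted G" "B \<in> G s"
  shows "\<exists>c\<in>leaves G. \<exists>r A. (r, A) \<in> c \<and> r \<le> s \<and> A \<subseteq> B"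
proof -
  obtain r A where "r \<le> s" "A \<subseteq> B" "leaf_point G r A"
    using assms unfolding rooted_def by blast
  then show ?thesis using leaf_exists[of r A] by blast
qed

text \<open>Two clusters of one level inside \<open>B\<close> have different leaves below them, and
  at most one of these is \<open>c\<close>. Failure to be a leaf point thus always exhibits a second
  leaf, the witness of a merger.\<close>

lemma other_leaf_below:
  assumes "rooted G" "B \<in> G s" "\<not> leaf_point G s B"
  shows "\<exists>d\<in>leaves G. d \<noteq> c \<and> (\<exists>r A. (r, A) \<in> d \<and> r \<le> s \<and> A \<subseteq> B)"
proof -
  obtain t A1 A2 where t: "t \<le> s" "A1 \<in> G t" "A2 \<in> G t" "A1 \<subseteq> B" "A2 \<subseteq> B" "A1 \<noteq> A2"
    using assms unfolding leaf_point_def by blast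
  obtain d1 r1 L1 where 1: "d1 \<in> leaves G" "(r1, L1) \<in> d1" "r1 \<le> t" "L1 \<subseteq> A1"
    using leaf_below[OF assms(1) t(2)] by blast
  obtain d2 r2 L2 where 2: "d2 \<in> leaves G" "(r2, L2) \<in> d2" "r2 \<le> t" "L2 \<subseteq> A2"
    using leaf_below[OF assms(1) t(3)] by blast
  have "d1 \<noteq> d2"
  proof
    assume "d1 = d2"
    then have "L1 \<inter> L2 \<noteq> {}" using leaf_overlap[OF 1(1,2)] 2(2) by blast
    then have "A1 \<inter> A2 \<noteq> {}" using 1(4) 2(4) by blast
    then show False using same_level[OF t(2,3)] t(6) by blast
  qed
  then consider "d1 \<noteq> c" | "d2 \<noteq> c" by blast
  then show ?thesis
  proof cases
    case 1
    have "r1 \<le> s" "L1 \<subseteq> B" using \<open>r1 \<le> t\<close> t \<open>L1 \<subseteq> A1\<close> by auto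
    with 1 show ?thesis using \<open>d1 \<in> leaves G\<close> \<open>(r1, L1) \<in> d1\<close> by blast
  next
    case 2
    have "r2 \<le> s" "L2 \<subseteq> B" using \<open>r2 \<le> t\<close> t \<open>L2 \<subseteq> A2\<close> by auto
    with 2 show ?thesis using \<open>d2 \<in> leaves G\<close> \<open>(r2, L2) \<in> d2\<close> by blast
  qed
qed

subsection \<open>Pruning\<close>

lemma prune_eq:
  assumes "0 \<le> \<tau>"
  shows "prune \<tau> G r = {B \<in> G r. \<exists>A\<in>G (r - \<tau>). A \<subseteq> B}"
  using hc_map_image[of "r - \<tau>" r] assms by (simp add: prune_def)

lemma hc_prune:
  assumes "0 \<le> \<tau>"
  shows "hc X (prune \<tau> G)"
proof
  have "refines (prune \<tau> G r) (prune \<tau> G s)" if rs: "r \<le> s" for r s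
    unfolding refines_def
  proof
    fix B assume "B \<in> prune \<tau> G r"
    then obtain A where A: "A \<in> G (r - \<tau>)" "A \<subseteq> B" and B: "B \<in> G r"
      using prune_eq[OF assms] by blast
    obtain B' where B': "B' \<in> G s" "B \<subseteq> B'" using up[OF B rs] by blast
    have "r - \<tau> \<le> s - \<tau>" using rs by simp
    then obtain A' where A': "A' \<in> G (s - \<tau>)" "A \<subseteq> A'" using up[OF A(1)] by blast
    have "A' \<inter> B' \<noteq> {}" using A A' B' nonempty[OF A(1)] by blast
    then have "A' \<subseteq> B'" using overlap[OF A'(1) B'(1)] assms by simp
    then show "\<exists>C\<in>prune \<tau> G s. B \<subseteq> C" using prune_eq[OF assms] A' B' by blast
  qed
  moreover have "clustering X (prune \<tau> G r)" for r
    using hier unfolding hier_clustering_def clustering_def prune_eq[OF assms] pairwise_def by blast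
  ultimately show "hier_clustering X UNIV (prune \<tau> G)"
    by (auto simp: hier_clustering_def monotone_on_def)
qed

lemma prune_prune:
  assumes "0 \<le> \<sigma>" "0 \<le> \<tau>"
  shows "prune \<tau> (prune \<sigma> G) = prune (\<sigma> + \<tau>) G"
proof (intro ext equalityI subsetI)
  fix r B
  interpret P: hc X "prune \<sigma> G" using hc_prune assms by blast
  have eq: "r - (\<sigma> + \<tau>) = r - \<tau> - \<sigma>" by simp
  have pos: "0 \<le> \<sigma> + \<tau>" using assms by simp
  {
    assume "B \<in> prune \<tau> (prune \<sigma> G) r"
    then obtain A where B: "B \<in> prune \<sigma> G r" and A: "A \<in> prune \<sigma> G (r - \<tau>)" "A \<subseteq> B"
      using P.prune_eq[OF assms(2)] by blast
    then show "B \<in> prune (\<sigma> + \<tau>) G r"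
      unfolding prune_eq[OF assms(1)] prune_eq[OF pos] eq by blast
  next
    assume "B \<in> prune (\<sigma> + \<tau>) G r"
    then obtain A where B: "B \<in> G r" and A: "A \<in> G (r - \<tau> - \<sigma>)" "A \<subseteq> B"
      unfolding prune_eq[OF pos] eq by blast
    obtain C where C: "C \<in> G (r - \<tau>)" "A \<subseteq> C" using up[OF A(1), of "r - \<tau>"] assms by auto
    obtain D where D: "D \<in> G (r - \<sigma>)" "A \<subseteq> D" using up[OF A(1), of "r - \<sigma>"] assms by auto
    have "C \<inter> B \<noteq> {}" "D \<inter> B \<noteq> {}" using A C D nonempty[OF A(1)] by blast+
    then have "C \<subseteq> B" "D \<subseteq> B" using overlap[OF C(1) B] overlap[OF D(1) B] assms by auto
    moreover have "C \<in> prune \<sigma> G (r - \<tau>)" using C A prune_eq[OF assms(1)] by blast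
    moreover have "B \<in> prune \<sigma> G r" using B D \<open>D \<subseteq> B\<close> prune_eq[OF assms(1)] by blast
    ultimately show "B \<in> prune \<tau> (prune \<sigma> G) r" using P.prune_eq[OF assms(2)] by blast
  }
qed

end

text \<open>Clusters of one leaf meet, so whatever contains them meets too. This is why sending a
  leaf of \<open>G\<close> to some leaf of \<open>F\<close> found inside it is injective.\<close>

lemma leaf_containing_unique:
  assumes "hc X F" "hc X G" and d: "d \<in> leaves F" "(q, A) \<in> d" "(q', A') \<in> d"
    and c: "c \<in> leaves G" "(r, B) \<in> c" "A \<subseteq> B"
    and c': "c' \<in> leaves G" "(r', B') \<in> c'" "A' \<subseteq> B'"
  shows "c = c'"
proof -
  have "A \<inter> A' \<noteq> {}" using hc.leaf_overlap[OF assms(1) d] .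
  then have "B \<inter> B' \<noteq> {}" using c c' by blast
  then show ?thesis using hc.leaf_eq[OF assms(2) c(1) c'(1) c(2) c'(2)] by blast
qed

lemma card_leaves_le:
  assumes "hc X F" "hc X G" "finite (leaves F)"
    and ex: "\<And>c. c \<in> leaves G \<Longrightarrow> \<exists>r B d q A. (r, B) \<in> c \<and> d \<in> leaves F \<and> (q, A) \<in> d \<and> A \<subseteq> B"
  shows "card (leaves G) \<le> card (leaves F)"
proof -
  obtain f where f: "\<And>c. c \<in> leaves G \<Longrightarrow> f c \<in> leaves F \<and> (\<exists>r B q A. (r, B) \<in> c \<and> (q, A) \<in> f c \<and> A \<subseteq> B)"
    using ex by metis
  have "inj_on f (leaves G)"
  proof (rule inj_onI)
    fix c c' assume c: "c \<in> leaves G" and c': "c' \<in> leaves G" and eq: "f c = f c'"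
    from f[OF c] obtain r B q A where 1: "(r, B) \<in> c" "(q, A) \<in> f c" "A \<subseteq> B" by blast
    from f[OF c'] eq obtain r' B' q' A' where 2: "(r', B') \<in> c'" "(q', A') \<in> f c" "A' \<subseteq> B'" by metis
    show "c = c'"
      using leaf_containing_unique[OF assms(1,2) _ 1(2) 2(2) c 1(1,3) c' 2(1,3)] f[OF c] by blast
  qed
  then show ?thesis using f assms(3) by (meson card_inj_on_le image_subsetI)
qed

text \<open>Send each leaf of \<open>prune \<eta> G\<close> to a leaf of \<open>G\<close> that lies
  at least \<eta> below one of its clusters. The map is injective, hence onto by the count. So some
  pruned leaf lies over \<open>d\<close>, and it lies over no other leaf; hence the branch of
  \<open>d\<close> cannot merge within time \<eta>.\<close>

lemma (in hc) leaf_long_life: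
  assumes root: "rooted G" and \<eta>: "0 \<le> \<eta>" and fin: "finite (leaves G)"
    and card: "card (leaves (prune \<eta> G)) = card (leaves G)"
    and d: "d \<in> leaves G"
  shows "\<exists>r A A'. (r, A) \<in> d \<and> (r + \<eta>, A') \<in> d"
proof -
  interpret P: hc X "prune \<eta> G" using hc_prune \<eta> .
  have hcs: "hc X G" "hc X (prune \<eta> G)" by unfold_locales
  define P where "P c d \<longleftrightarrow> d \<in> leaves G \<and>
    (\<exists>r B q A. (r, B) \<in> c \<and> (q, A) \<in> d \<and> q \<le> r - \<eta> \<and> A \<subseteq> B)" for c d :: "(real \<times> 'a set) set"
  have "\<exists>d. P c d" if c: "c \<in> leaves (prune \<eta> G)" for c
  proof -
    obtain r B where B: "(r, B) \<in> c" using P.leaf_nonempty[OF c] by blast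
    then obtain A where A: "A \<in> G (r - \<eta>)" "A \<subseteq> B"
      using P.leaf_level[OF c B] prune_eq[OF \<eta>] by blast
    obtain d q D where "d \<in> leaves G" "(q, D) \<in> d" "q \<le> r - \<eta>" "D \<subseteq> A"
      using leaf_below[OF root A(1)] by blast
    then have "P c d" using A(2) B unfolding P_def by blast
    then show ?thesis by blast
  qed
  then obtain f where f: "\<And>c. c \<in> leaves (prune \<eta> G) \<Longrightarrow> P c (f c)" by metis
  have inj: "inj_on f (leaves (prune \<eta> G))"
  proof (rule inj_onI)
    fix c c' assume c: "c \<in> leaves (prune \<eta> G)" and c': "c' \<in> leaves (prune \<eta> G)" and eq: "f c = f c'"
    from f[OF c] obtain r B q A where 1: "f c \<in> leaves G" "(r, B) \<in> c" "(q, A) \<in> f c" "A \<subseteq> B"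
      unfolding P_def by blast
    from f[OF c'] eq obtain r' B' q' A' where 2: "(r', B') \<in> c'" "(q', A') \<in> f c" "A' \<subseteq> B'"
      unfolding P_def by metis
    show "c = c'"
      using leaf_containing_unique[OF hcs 1(1) 1(3) 2(2) c 1(2,4) c' 2(1,3)] .
  qed
  have "f ` leaves (prune \<eta> G) = leaves G"
  proof (rule card_subset_eq[OF fin])
    show "f ` leaves (prune \<eta> G) \<subseteq> leaves G" using f unfolding P_def by blast
    show "card (f ` leaves (prune \<eta> G)) = card (leaves G)" using card_image[OF inj] card by simp
  qed
  then have surj: "\<exists>c\<in>leaves (prune \<eta> G). f c = e" if "e \<in> leaves G" for e
    using that by (metis imageE)
  obtain c where c: "c \<in> leaves (prune \<eta> G)" "f c = d" using surj[OF d] by blast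
  then obtain r B q D where rB: "(r, B) \<in> c" and qD: "(q, D) \<in> d" and le: "q \<le> r - \<eta>" and DB: "D \<subseteq> B"
    using f[OF c(1)] unfolding P_def by blast
  have Dq: "D \<in> G q" using leaf_level[OF d qD] .
  obtain M where M: "M \<in> G (q + \<eta>)" "D \<subseteq> M" using up[OF Dq, of "q + \<eta>"] \<eta> by auto
  have "M \<in> prune \<eta> G (q + \<eta>)" using M Dq prune_eq[OF \<eta>] by auto
  moreover have "M \<inter> B \<noteq> {}" using M DB nonempty[OF Dq] by blast
  ultimately have MB: "M \<subseteq> B" using P.overlap[OF _ P.leaf_level[OF c(1) rB]] le by simp
  \<comment> \<open>A second leaf \<open>e\<close> below \<open>M\<close> is also a value of
    \<open>f\<close>, at some \<open>c2\<close>. Then \<open>c\<close> and \<open>c2\<close> both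
    contain clusters of \<open>e\<close>, so they agree and \<open>e = d\<close>.\<close>
  have "leaf_point G (q + \<eta>) M"
  proof (rule ccontr)
    assume "\<not> leaf_point G (q + \<eta>) M"
    then obtain e u L where e: "e \<in> leaves G" "e \<noteq> d" "(u, L) \<in> e" "L \<subseteq> M"
      using other_leaf_below[OF root M(1)] by metis
    obtain c2 where c2: "c2 \<in> leaves (prune \<eta> G)" "f c2 = e" using surj[OF e(1)] by blast
    then obtain r2 B2 q2 D2 where 2: "(r2, B2) \<in> c2" "(q2, D2) \<in> e" "D2 \<subseteq> B2"
      using f[OF c2(1)] unfolding P_def by blast
    have "L \<subseteq> B" using e(4) MB by blast
    then have "c = c2"
      using leaf_containing_unique[OF hcs e(1) e(3) 2(2) c(1) rB _ c2(1) 2(1,3)] by blast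
    then show False using c c2 e by blast
  qed
  moreover have "D \<inter> M \<noteq> {}" using M nonempty[OF Dq] by blast
  ultimately have "(q + \<eta>, M) \<in> d" using leaf_mem[OF d qD] by blast
  with qD show ?thesis by blast
qed

subsection \<open>Matching the leaves of interleaved clusterings\<close>

text \<open>Asymmetric on its face, and required at a single level only; \<open>linked_sym\<close>
  recovers the other direction for leaves that live long enough.\<close>

definition linked :: "real \<Rightarrow> 'a pcluster \<Rightarrow> 'a pcluster \<Rightarrow> bool" where
  "linked \<eta> c d \<longleftrightarrow> (\<exists>s A B. (s, A) \<in> c \<and> (s + \<eta>, B) \<in> d \<and> A \<subseteq> B)"

text \<open>The lifetime \<open>2 * \<eta>\<close> is the cost of crossing the interleaving and
  coming back.\<close>

locale hc_pair = G: hc Z G + F: hc Z F for Z :: "'a set" and G F +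
  fixes \<eta> :: real
  assumes eta: "0 \<le> \<eta>"
    and rooted_G: "rooted G" and rooted_F: "rooted F"
    and G_F: "\<And>r A. A \<in> G r \<Longrightarrow> \<exists>B\<in>F (r + \<eta>). A \<subseteq> B"
    and F_G: "\<And>r A. A \<in> F r \<Longrightarrow> \<exists>B\<in>G (r + \<eta>). A \<subseteq> B"
    and long_G: "\<And>c. c \<in> leaves G \<Longrightarrow> \<exists>r A A'. (r, A) \<in> c \<and> (r + 2 * \<eta>, A') \<in> c"
    and long_F: "\<And>c. c \<in> leaves F \<Longrightarrow> \<exists>r A A'. (r, A) \<in> c \<and> (r + 2 * \<eta>, A') \<in> c"
begin

lemma swap: "hc_pair Z F G \<eta>"
  by unfold_locales (use eta rooted_G rooted_F G_F F_G long_G long_F in auto)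

text \<open>Lives are convex, so the window of length \<open>2 * \<eta>\<close> can be slid down
  until it starts no later than \<open>s\<close>.\<close>

lemma early:
  assumes c: "c \<in> leaves G" "(s, C) \<in> c"
  shows "\<exists>r\<le>s. \<exists>A A'. (r, A) \<in> c \<and> (r + 2 * \<eta>, A') \<in> c"
proof -
  obtain r A A' where r: "(r, A) \<in> c" "(r + 2 * \<eta>, A') \<in> c" using long_G[OF c(1)] by blast
  show ?thesis
  proof (cases "r \<le> s")
    case False
    then have "\<exists>D. (s + 2 * \<eta>, D) \<in> c" using G.leaf_convex[OF c r(2)] eta by simp
    then show ?thesis using c(2) by blast
  qed (use r in blast)
qed

text \<open>A cluster early in \<open>c\<close> crosses to a cluster that meets one of
  \<open>d\<close> at the same or a later level, and hence belongs to \<open>d\<close>. Its return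
  has room to land in \<open>c\<close> again, because \<open>c\<close> still lives
  \<open>2 * \<eta>\<close> after the start.\<close>

lemma linked_sym:
  assumes c: "c \<in> leaves G" and d: "d \<in> leaves F" and "linked \<eta> c d"
  shows "linked \<eta> d c"
proof -
  obtain s C D where l: "(s, C) \<in> c" "(s + \<eta>, D) \<in> d" "C \<subseteq> D"
    using assms(3) unfolding linked_def by blast
  obtain r A A' where r: "r \<le> s" "(r, A) \<in> c" "(r + 2 * \<eta>, A') \<in> c" using early[OF c l(1)] by blast
  have Ar: "A \<in> G r" using G.leaf_level[OF c r(2)] .
  obtain B where B: "B \<in> F (r + \<eta>)" "A \<subseteq> B" using G_F[OF Ar] by blast
  have "A \<subseteq> C" using G.leaf_mono[OF c r(2) l(1) r(1)] .
  then have "B \<inter> D \<noteq> {}" using B l(3) G.nonempty[OF Ar] by blast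
  then have Bd: "(r + \<eta>, B) \<in> d" using F.leaf_down[OF d l(2) B(1)] r(1) by simp
  obtain A2 where A2: "A2 \<in> G (r + \<eta> + \<eta>)" "B \<subseteq> A2" using F_G[OF B(1)] by blast
  have "A \<subseteq> A'" using G.leaf_mono[OF c r(2,3)] eta by simp
  then have "A2 \<inter> A' \<noteq> {}" using A2 B G.nonempty[OF Ar] by blast
  moreover have eq: "r + \<eta> + \<eta> = r + 2 * \<eta>" by simp
  ultimately have "A2 = A'" using G.same_level A2(1) G.leaf_level[OF c r(3)] by metis
  then have "(r + \<eta> + \<eta>, A2) \<in> c" using r(3) unfolding eq by blast
  then show ?thesis unfolding linked_def using Bd A2(2) by blast
qed

lemma linked_unique:
  assumes c: "c \<in> leaves G" and d: "d \<in> leaves F" and d': "d' \<in> leaves F"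
    and l: "linked \<eta> c d" and l': "linked \<eta> c d'"
  shows "d = d'"
proof -
  obtain s C D where 1: "(s, C) \<in> c" "(s + \<eta>, D) \<in> d" "C \<subseteq> D"
    using l unfolding linked_def by blast
  obtain s' C' D' where 2: "(s', C') \<in> c" "(s' + \<eta>, D') \<in> d'" "C' \<subseteq> D'"
    using l' unfolding linked_def by blast
  show ?thesis
    using leaf_containing_unique[OF G.hc_axioms F.hc_axioms c 1(1) 2(1) d 1(2,3) d' 2(2,3)] .
qed

text \<open>The return trip pins down the partner: whatever leaf of \<open>F\<close> is found below
  the image of \<open>A\<close> comes back inside \<open>A'\<close>, which still belongs to
  \<open>c\<close>.\<close>

lemma linked_below_image:
  assumes c: "c \<in> leaves G" "(r, A) \<in> c" "(r + 2 * \<eta>, A') \<in> c"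
    and B: "B \<in> F (r + \<eta>)" "A \<subseteq> B"
    and d: "d \<in> leaves F" "(s, D) \<in> d" "s \<le> r + \<eta>" "D \<subseteq> B"
  shows "linked \<eta> d c"
proof -
  have Ar: "A \<in> G r" using G.leaf_level[OF c(1,2)] .
  have Ds: "D \<in> F s" using F.leaf_level[OF d(1,2)] .
  obtain C where C: "C \<in> G (s + \<eta>)" "D \<subseteq> C" using F_G[OF Ds] by blast
  obtain A2 where A2: "A2 \<in> G (r + \<eta> + \<eta>)" "B \<subseteq> A2" using F_G[OF B(1)] by blast
  have "A \<subseteq> A'" using G.leaf_mono[OF c] eta by simp
  then have "A2 \<inter> A' \<noteq> {}" using A2 B G.nonempty[OF Ar] by blast
  moreover have eq: "r + \<eta> + \<eta> = r + 2 * \<eta>" by simp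
  ultimately have "A2 = A'" using G.same_level A2(1) G.leaf_level[OF c(1,3)] by metis
  then have "C \<inter> A' \<noteq> {}" using C A2 d(4) F.nonempty[OF Ds] by blast
  then have "(s + \<eta>, C) \<in> c" using G.leaf_down[OF c(1,3) C(1)] d(3) by simp
  then show ?thesis unfolding linked_def using d(2) C(2) by blast
qed

lemma linked_exists:
  assumes c: "c \<in> leaves G"
  shows "\<exists>d\<in>leaves F. linked \<eta> c d"
proof -
  interpret S: hc_pair Z F G \<eta> by (rule swap)
  obtain r A A' where r: "(r, A) \<in> c" "(r + 2 * \<eta>, A') \<in> c" using long_G[OF c] by blast
  obtain B where B: "B \<in> F (r + \<eta>)" "A \<subseteq> B" using G_F[OF G.leaf_level[OF c r(1)]] by blast
  obtain d s D where d: "d \<in> leaves F" "(s, D) \<in> d" "s \<le> r + \<eta>" "D \<subseteq> B"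
    using F.leaf_below[OF rooted_F B(1)] by blast
  have "linked \<eta> d c" using linked_below_image[OF c r B d] .
  then show ?thesis using S.linked_sym[OF d(1) c] d(1) by blast
qed

text \<open>The image of \<open>A\<close> may already be a merged cluster outside \<open>d\<close>.
  But it contains the image of an early cluster of \<open>c\<close>, and the leaf found below that
  one is linked to \<open>c\<close>, hence is \<open>d\<close>.\<close>

lemma linked_below:
  assumes c: "c \<in> leaves G" and d: "d \<in> leaves F" and l: "linked \<eta> c d"
    and A: "(r, A) \<in> c" and B: "B \<in> F (r + \<eta>)" "A \<subseteq> B"
  shows "\<exists>s D. (s, D) \<in> d \<and> s \<le> r + \<eta> \<and> D \<subseteq> B"
proof -
  interpret S: hc_pair Z F G \<eta> by (rule swap)
  obtain q A0 A' where q: "q \<le> r" "(q, A0) \<in> c" "(q + 2 * \<eta>, A') \<in> c" using early[OF c A] by blast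
  have A0: "A0 \<in> G q" using G.leaf_level[OF c q(2)] .
  obtain B0 where B0: "B0 \<in> F (q + \<eta>)" "A0 \<subseteq> B0" using G_F[OF A0] by blast
  obtain e s D where e: "e \<in> leaves F" "(s, D) \<in> e" "s \<le> q + \<eta>" "D \<subseteq> B0"
    using F.leaf_below[OF rooted_F B0(1)] by blast
  have "linked \<eta> c e" using S.linked_sym[OF e(1) c linked_below_image[OF c q(2,3) B0 e]] .
  then have "e = d" using linked_unique[OF c e(1) d _ l] by blast
  moreover have "A0 \<subseteq> A" using G.leaf_mono[OF c q(2) A q(1)] .
  then have "B0 \<inter> B \<noteq> {}" using B B0 G.nonempty[OF A0] by blast
  then have "B0 \<subseteq> B" using F.overlap[OF B0(1) B(1)] q(1) by simp
  ultimately show ?thesis using e q(1) by (intro exI[of _ s] exI[of _ D]) auto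
qed

text \<open>While \<open>c\<close> lives, \<open>d\<close> has been born by \<eta> later; if
  \<open>d\<close> has also ended by then, its extension is \<open>Z\<close>, which contains
  everything. The real content is death: once \<open>c\<close> has ended, its extension is
  \<open>Z\<close>, so \<open>d\<close> must have ended \<eta> later.\<close>

lemma linked_refines:
  assumes c: "c \<in> leaves G" and d: "d \<in> leaves F" and l: "linked \<eta> c d"
  shows "refines (hc_ext Z (life c) (pc_hc c) r) (hc_ext Z (life d) (pc_hc d) (r + \<eta>))"
proof (cases "r \<in> life c")
  case True
  then obtain A where A: "(r, A) \<in> c" by (auto simp: life_def)
  have Ar: "A \<in> G r" using G.leaf_level[OF c A] .
  obtain B where B: "B \<in> F (r + \<eta>)" "A \<subseteq> B" using G_F[OF Ar] by blast
  obtain s D where D: "(s, D) \<in> d" "s \<le> r + \<eta>" "D \<subseteq> B" using linked_below[OF c d l A B] by blast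
  have eC: "hc_ext Z (life c) (pc_hc c) r = {A}"
    using True G.leaf_at[OF c A] by (simp add: hc_ext_def pc_hc_def)
  show ?thesis
  proof (cases "r + \<eta> \<in> life d")
    case True
    then obtain D2 where D2: "(r + \<eta>, D2) \<in> d" by (auto simp: life_def)
    have "D \<inter> D2 \<noteq> {}" using F.leaf_overlap[OF d D(1) D2] .
    then have "D2 = B" using F.same_level[OF F.leaf_level[OF d D2] B(1)] D(3) by blast
    then have "hc_ext Z (life d) (pc_hc d) (r + \<eta>) = {B}"
      using True F.leaf_at[OF d D2] by (simp add: hc_ext_def pc_hc_def)
    then show ?thesis using eC B(2) by (simp add: refines_def)
  next
    case False
    have sl: "s \<in> life d" using D(1) by (force simp: life_def)
    then have "s < r + \<eta>" using D(2) False by (metis order_le_less)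
    then have "hc_ext Z (life d) (pc_hc d) (r + \<eta>) = {Z}"
      using False sl by (auto simp: hc_ext_def)
    then show ?thesis using eC G.subset_X[OF Ar] by (simp add: refines_def)
  qed
next
  case notin: False
  show ?thesis
  proof (cases "\<exists>p\<in>life c. p < r")
    case False
    then have "hc_ext Z (life c) (pc_hc c) r = {}" using notin by (simp add: hc_ext_def)
    then show ?thesis by (simp add: refines_def)
  next
    case True
    then obtain p A where p: "(p, A) \<in> c" "p < r" by (auto simp: life_def)
    have eC: "hc_ext Z (life c) (pc_hc c) r = {Z}"
      using True notin by (simp add: hc_ext_def)
    have Ap: "A \<in> G p" using G.leaf_level[OF c p(1)] .
    obtain B where B: "B \<in> G r" "A \<subseteq> B" using G.up[OF Ap, of r] p(2) by auto
    obtain A1 where A1: "A1 \<in> F (p + \<eta>)" "A \<subseteq> A1" using G_F[OF Ap] by blast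
    obtain s D where D: "(s, D) \<in> d" "s \<le> p + \<eta>" "D \<subseteq> A1" using linked_below[OF c d l p(1) A1] by blast
    have sl: "s \<in> life d" using D(1) by (force simp: life_def)
    \<comment> \<open>The leaf \<open>c\<close> was born before \<open>r\<close> and is absent at
      \<open>r\<close>, so its branch has lost the leaf property and holds a second leaf
      \<open>e\<close>.\<close>
    have "\<not> leaf_point G r B"
    proof
      assume "leaf_point G r B"
      moreover have "A \<inter> B \<noteq> {}" using B(2) G.nonempty[OF Ap] by blast
      ultimately have "(r, B) \<in> c" using G.leaf_mem[OF c p(1)] by blast
      then show False using notin by (force simp: life_def)
    qed
    then obtain e u L where e: "e \<in> leaves G" "e \<noteq> c" "(u, L) \<in> e" "u \<le> r" "L \<subseteq> B"
      using G.other_leaf_below[OF rooted_G B(1)] by metis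
    have Lu: "L \<in> G u" using G.leaf_level[OF e(1,3)] .
    obtain L1 where L1: "L1 \<in> F (u + \<eta>)" "L \<subseteq> L1" using G_F[OF Lu] by blast
    obtain e' where e': "e' \<in> leaves F" "linked \<eta> e e'" using linked_exists[OF e(1)] by blast
    obtain s' D' where D': "(s', D') \<in> e'" "s' \<le> u + \<eta>" "D' \<subseteq> L1"
      using linked_below[OF e(1) e' e(3) L1] by blast
    obtain B1 where B1: "B1 \<in> F (r + \<eta>)" "B \<subseteq> B1" using G_F[OF B(1)] by blast
    have "A1 \<inter> B1 \<noteq> {}" using A1 B B1 G.nonempty[OF Ap] by blast
    then have AB: "A1 \<subseteq> B1" using F.overlap[OF A1(1) B1(1)] p(2) by simp
    have "L1 \<inter> B1 \<noteq> {}" using L1 e(5) B1 G.nonempty[OF Lu] by blast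
    then have LB: "L1 \<subseteq> B1" using F.overlap[OF L1(1) B1(1)] e(4) by simp
    \<comment> \<open>If \<open>d\<close> were still alive, its cluster would be \<open>B1\<close>,
      which also contains a cluster of the partner \<open>e'\<close> of \<open>e\<close>. Leaves
      that meet coincide, so \<open>c\<close> and \<open>e\<close> would share a partner.\<close>
    have "r + \<eta> \<notin> life d"
    proof
      assume "r + \<eta> \<in> life d"
      then obtain D2 where D2: "(r + \<eta>, D2) \<in> d" by (auto simp: life_def)
      have "D \<inter> D2 \<noteq> {}" using F.leaf_overlap[OF d D(1) D2] .
      then have "D2 \<inter> B1 \<noteq> {}" using D(3) AB by blast
      then have "D2 = B1" using F.same_level[OF F.leaf_level[OF d D2] B1(1)] by blast
      then have "D' \<inter> D2 \<noteq> {}" using D'(3) LB F.nonempty[OF F.leaf_level[OF e'(1) D'(1)]] by blast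
      then have "e' = d" using F.leaf_eq[OF e'(1) d D'(1) D2] by blast
      then have "linked \<eta> d e" "linked \<eta> d c" using linked_sym e e' c d l by blast+
      then show False
        using hc_pair.linked_unique[OF swap d e(1) c] e(2) by blast
    qed
    moreover have "s < r + \<eta>" using D(2) p(2) by simp
    ultimately have "hc_ext Z (life d) (pc_hc d) (r + \<eta>) = {Z}"
      using sl by (auto simp: hc_ext_def)
    then show ?thesis using eC by (simp add: refines_def)
  qed
qed

lemma leaves_matching:
  "\<exists>m. bij_betw m (leaves G) (leaves F) \<and>
     (\<forall>c\<in>leaves G. interleaved Z \<eta> (life c) (pc_hc c) (life (m c)) (pc_hc (m c)))"
proof -
  interpret S: hc_pair Z F G \<eta> by (rule swap)
  obtain m where m: "\<And>c. c \<in> leaves G \<Longrightarrow> m c \<in> leaves F \<and> linked \<eta> c (m c)"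
    using linked_exists by metis
  have "bij_betw m (leaves G) (leaves F)"
  proof (rule bij_betw_imageI)
    show "inj_on m (leaves G)"
    proof (rule inj_onI)
      fix c c' assume c: "c \<in> leaves G" "c' \<in> leaves G" "m c = m c'"
      then have "linked \<eta> (m c) c" "linked \<eta> (m c) c'" using linked_sym m by metis+
      then show "c = c'" using S.linked_unique m c by blast
    qed
    show "m ` leaves G = leaves F"
    proof (intro equalityI subsetI)
      fix d assume d: "d \<in> leaves F"
      obtain c where c: "c \<in> leaves G" "linked \<eta> d c" using S.linked_exists[OF d] by blast
      then have "linked \<eta> c d" using S.linked_sym[OF d] by blast
      then have "m c = d" using linked_unique[OF c(1) _ d] m[OF c(1)] by blast
      then show "d \<in> m ` leaves G" using c by blast
    qed (use m in blast)
  qed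
  moreover have "interleaved Z \<eta> (life c) (pc_hc c) (life (m c)) (pc_hc (m c))" if c: "c \<in> leaves G" for c
  proof -
    have l: "m c \<in> leaves F" "linked \<eta> c (m c)" using m c by auto
    then have "linked \<eta> (m c) c" using linked_sym c by blast
    then show ?thesis
      using linked_refines[OF c l] S.linked_refines[OF l(1) c] by (simp add: interleaved_def)
  qed
  ultimately show ?thesis by blast
qed

end

subsection \<open>Pullback along a surjection\<close>

abbreviation pullback_pc :: "'c set \<Rightarrow> ('c \<Rightarrow> 'a) \<Rightarrow> 'a pcluster \<Rightarrow> 'c pcluster" where
  "pullback_pc Z \<psi> c \<equiv> map_prod id (\<lambda>A. \<psi> -` A \<inter> Z) ` c"

text \<open>Surjectivity lets preimages reflect inclusion and disjointness, not merely preserve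
  them, so nesting and leaves are unchanged.\<close>

locale hc_pullback = hc X G for X :: "'a set" and G +
  fixes Z :: "'c set" and \<psi> :: "'c \<Rightarrow> 'a"
  assumes surj: "\<psi> ` Z = X"
begin

abbreviation pb where "pb A \<equiv> \<psi> -` A \<inter> Z"

lemma pb_subset_iff: "A \<subseteq> X \<Longrightarrow> pb A \<subseteq> pb B \<longleftrightarrow> A \<subseteq> B"
  using surj by blast

lemma pb_disjoint_iff: "A \<subseteq> X \<Longrightarrow> pb A \<inter> pb B = {} \<longleftrightarrow> A \<inter> B = {}"
  using surj by blast

lemma pb_inj: "inj_on pb (Pow X)"
  by (rule inj_onI) (metis PowD pb_subset_iff order_antisym order_refl)

lemma pb_eq: "A \<in> G r \<Longrightarrow> B \<in> G s \<Longrightarrow> pb A = pb B \<longleftrightarrow> A = B"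
  using pb_inj subset_X by (metis PowI inj_on_def)

lemma in_pullback: "A' \<in> pullback Z \<psi> G r \<longleftrightarrow> (\<exists>A\<in>G r. A' = pb A)"
  by (auto simp: pullback_def)

lemma hc_pullback: "hc Z (pullback Z \<psi> G)"
proof
  have "clustering Z (pullback Z \<psi> G r)" for r
    unfolding clustering_def
  proof (intro conjI)
    show "pullback Z \<psi> G r \<subseteq> Pow Z" by (auto simp: pullback_def)
    show "{} \<notin> pullback Z \<psi> G r"
    proof
      assume "{} \<in> pullback Z \<psi> G r"
      then obtain A where "A \<in> G r" "pb A = {}" unfolding in_pullback by blast
      then show False using pb_disjoint_iff[OF subset_X, of A r A] nonempty[of A r] by auto
    qed
    show "disjoint (pullback Z \<psi> G r)"
    proof (rule pairwiseI)
      fix A' B' assume "A' \<in> pullback Z \<psi> G r" "B' \<in> pullback Z \<psi> G r" and ne: "A' \<noteq> B'"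
      then obtain A B where A: "A \<in> G r" "A' = pb A" and B: "B \<in> G r" "B' = pb B"
        unfolding in_pullback by blast
      then have "A \<inter> B = {}" using same_level[OF A(1) B(1)] ne by blast
      then show "disjnt A' B'" using A B unfolding disjnt_def by blast
    qed
  qed
  moreover have "refines (pullback Z \<psi> G r) (pullback Z \<psi> G s)" if rs: "r \<le> s" for r s
    unfolding refines_def
  proof
    fix A' assume "A' \<in> pullback Z \<psi> G r"
    then obtain A where A: "A \<in> G r" "A' = pb A" unfolding in_pullback by blast
    obtain B where "B \<in> G s" "A \<subseteq> B" using up[OF A(1) rs] by blast
    then have "pb B \<in> pullback Z \<psi> G s" "A' \<subseteq> pb B" using A(2) by (auto simp: pullback_def)
    then show "\<exists>B'\<in>pullback Z \<psi> G s. A' \<subseteq> B'" by blast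
  qed
  ultimately show "hier_clustering Z UNIV (pullback Z \<psi> G)"
    by (auto simp: hier_clustering_def monotone_on_def)
qed

sublocale P: hc Z "pullback Z \<psi> G"
  by (rule hc_pullback)

lemma leaf_point_pullback:
  assumes "B \<in> G s"
  shows "leaf_point (pullback Z \<psi> G) s (pb B) \<longleftrightarrow> leaf_point G s B"
proof
  assume l: "leaf_point (pullback Z \<psi> G) s (pb B)"
  show "leaf_point G s B"
    unfolding leaf_point_def
  proof (intro conjI allI impI ballI assms)
    fix r A A' assume r: "r \<le> s" and A: "A \<in> G r" "A' \<in> G r" "A \<subseteq> B" "A' \<subseteq> B"
    have "pb A \<in> pullback Z \<psi> G r" "pb A' \<in> pullback Z \<psi> G r" "pb A \<subseteq> pb B" "pb A' \<subseteq> pb B"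
      using A by (auto simp: pullback_def)
    then have "pb A = pb A'" using P.leaf_pointD[OF l r] by blast
    then show "A = A'" using pb_eq A by blast
  qed
next
  assume l: "leaf_point G s B"
  show "leaf_point (pullback Z \<psi> G) s (pb B)"
    unfolding leaf_point_def
  proof (intro conjI allI impI ballI)
    show "pb B \<in> pullback Z \<psi> G s" using assms by (auto simp: pullback_def)
    fix r C C' assume r: "r \<le> s" and C: "C \<in> pullback Z \<psi> G r" "C' \<in> pullback Z \<psi> G r" "C \<subseteq> pb B" "C' \<subseteq> pb B"
    then obtain A A' where A: "A \<in> G r" "C = pb A" "A' \<in> G r" "C' = pb A'" unfolding in_pullback by blast
    then have "A \<subseteq> B" "A' \<subseteq> B" using C pb_subset_iff subset_X by metis+
    then show "C = C'" using leaf_pointD[OF l r] A by blast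
  qed
qed

lemma leaf_class_pullback:
  assumes "leaf_point G s B"
  shows "leaf_class (pullback Z \<psi> G) (pb B) = pullback_pc Z \<psi> (leaf_class G B)"
proof (intro equalityI subsetI)
  fix x assume "x \<in> leaf_class (pullback Z \<psi> G) (pb B)"
  then obtain r A' where x: "x = (r, A')" "leaf_point (pullback Z \<psi> G) r A'" "A' \<inter> pb B \<noteq> {}"
    unfolding leaf_class_def by blast
  then obtain A where A: "A \<in> G r" "A' = pb A" using P.leaf_point_level[OF x(2)] in_pullback by blast
  then have "leaf_point G r A" "A \<inter> B \<noteq> {}"
    using x leaf_point_pullback by blast+
  then have "(r, A) \<in> leaf_class G B" by (simp add: leaf_class_def)
  then show "x \<in> pullback_pc Z \<psi> (leaf_class G B)" using x(1) A(2) by force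
next
  fix x assume "x \<in> pullback_pc Z \<psi> (leaf_class G B)"
  then obtain p where p: "x = map_prod id pb p" "p \<in> leaf_class G B" by (rule imageE)
  obtain r A where rA: "p = (r, A)" by (cases p)
  have x: "x = (r, pb A)" and A: "leaf_point G r A" "A \<inter> B \<noteq> {}"
    using p unfolding rA by (simp_all add: leaf_class_def)
  have "A \<in> G r" using leaf_point_level[OF A(1)] .
  then have "leaf_point (pullback Z \<psi> G) r (pb A)" "pb A \<inter> pb B \<noteq> {}"
    using leaf_point_pullback A pb_disjoint_iff[OF subset_X, of A r B] by auto
  then show "x \<in> leaf_class (pullback Z \<psi> G) (pb B)" by (simp add: x leaf_class_def)
qed

lemma leaves_pullback: "leaves (pullback Z \<psi> G) = pullback_pc Z \<psi> ` leaves G"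
proof (intro equalityI subsetI)
  fix c assume "c \<in> leaves (pullback Z \<psi> G)"
  then obtain s B' where B': "leaf_point (pullback Z \<psi> G) s B'" "c = leaf_class (pullback Z \<psi> G) B'"
    unfolding P.leaves_eq by blast
  then obtain B where B: "B \<in> G s" "B' = pb B" using P.leaf_point_level[OF B'(1)] in_pullback by blast
  then have l: "leaf_point G s B" using leaf_point_pullback B' by blast
  then have "c = pullback_pc Z \<psi> (leaf_class G B)" using leaf_class_pullback B' B by simp
  moreover have "leaf_class G B \<in> leaves G" using l leaves_eq by blast
  ultimately show "c \<in> pullback_pc Z \<psi> ` leaves G" by blast
next
  fix c assume "c \<in> pullback_pc Z \<psi> ` leaves G"
  then obtain s B where B: "leaf_point G s B" "c = pullback_pc Z \<psi> (leaf_class G B)"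
    unfolding leaves_eq by blast
  then have "c = leaf_class (pullback Z \<psi> G) (pb B)" using leaf_class_pullback by simp
  moreover have "leaf_point (pullback Z \<psi> G) s (pb B)"
    using leaf_point_pullback leaf_point_level[OF B(1)] B(1) by blast
  ultimately show "c \<in> leaves (pullback Z \<psi> G)" unfolding P.leaves_eq by blast
qed

lemma inj_pullback_pc: "inj_on (pullback_pc Z \<psi>) (leaves G)"
proof (rule inj_on_image)
  have "\<Union> (leaves G) \<subseteq> UNIV \<times> Pow X"
  proof
    fix x assume "x \<in> \<Union> (leaves G)"
    then obtain c r A where "c \<in> leaves G" "x = (r, A)" "(r, A) \<in> c" by (metis UnionE surj_pair)
    then show "x \<in> UNIV \<times> Pow X" using subset_X[OF leaf_level] by blast
  qed
  moreover have "inj_on (map_prod id pb) (UNIV \<times> Pow X)"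
    by (rule map_prod_inj_on[OF inj_on_id pb_inj])
  ultimately show "inj_on (map_prod id pb) (\<Union> (leaves G))" by (rule inj_on_subset[rotated])
qed

lemma life_pullback_pc: "life (pullback_pc Z \<psi> c) = life c"
  by (force simp: life_def image_image)

text \<open>Agreement is claimed for the extensions only: off the life, \<open>pc_at\<close> is an
  unspecified value of \<open>THE\<close>, which pullback need not respect.\<close>

lemma hc_ext_pullback_pc:
  assumes "c \<in> leaves G"
  shows "hc_ext Z (life c) (pullback Z \<psi> (pc_hc c)) =
    hc_ext Z (life (pullback_pc Z \<psi> c)) (pc_hc (pullback_pc Z \<psi> c))"
proof
  fix r
  have "pullback Z \<psi> (pc_hc c) r = pc_hc (pullback_pc Z \<psi> c) r" if r: "r \<in> life c"
  proof -
    obtain A where A: "(r, A) \<in> c" using r by (auto simp: life_def)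
    then have "(r, pb A) \<in> pullback_pc Z \<psi> c" by force
    moreover have "pullback_pc Z \<psi> c \<in> leaves (pullback Z \<psi> G)" using assms leaves_pullback by blast
    ultimately have "pc_at (pullback_pc Z \<psi> c) r = pb A" using P.leaf_at by blast
    then show ?thesis using leaf_at[OF assms A] by (simp add: pullback_def pc_hc_def)
  qed
  then show "hc_ext Z (life c) (pullback Z \<psi> (pc_hc c)) r =
    hc_ext Z (life (pullback_pc Z \<psi> c)) (pc_hc (pullback_pc Z \<psi> c)) r"
    by (simp only: hc_ext_def life_pullback_pc) simp
qed

lemma rooted_pullback:
  assumes "rooted G"
  shows "rooted (pullback Z \<psi> G)"
  unfolding rooted_def
proof (intro allI ballI)
  fix s B' assume "B' \<in> pullback Z \<psi> G s"
  then obtain B where B: "B \<in> G s" "B' = pb B" unfolding in_pullback by blast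
  then obtain r A where A: "r \<le> s" "A \<subseteq> B" "leaf_point G r A"
    using assms unfolding rooted_def by blast
  then have "leaf_point (pullback Z \<psi> G) r (pb A)" "pb A \<subseteq> B'"
    using leaf_point_pullback leaf_point_level B by blast+
  then show "\<exists>r\<le>s. \<exists>A\<subseteq>B'. leaf_point (pullback Z \<psi> G) r A" using A(1) by blast
qed

lemma prune_pullback:
  assumes "0 \<le> \<tau>"
  shows "prune \<tau> (pullback Z \<psi> G) = pullback Z \<psi> (prune \<tau> G)"
proof
  fix r
  show "prune \<tau> (pullback Z \<psi> G) r = pullback Z \<psi> (prune \<tau> G) r" (is "?L = ?R")
  proof (intro equalityI subsetI)
    fix B' assume "B' \<in> ?L"
    then obtain A' where "B' \<in> pullback Z \<psi> G r" "A' \<in> pullback Z \<psi> G (r - \<tau>)" "A' \<subseteq> B'"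
      unfolding P.prune_eq[OF assms] by blast
    then obtain A B where "B \<in> G r" "B' = pb B" "A \<in> G (r - \<tau>)" "A' = pb A" "A' \<subseteq> B'"
      unfolding in_pullback by blast
    then have "B \<in> prune \<tau> G r" "B' = pb B"
      using pb_subset_iff[OF subset_X[of A "r - \<tau>"]] prune_eq[OF assms] by auto
    then show "B' \<in> ?R" by (auto simp: pullback_def)
  next
    fix B' assume "B' \<in> ?R"
    then obtain A B where "B \<in> G r" "B' = pb B" "A \<in> G (r - \<tau>)" "A \<subseteq> B"
      using prune_eq[OF assms] by (auto simp: pullback_def)
    then have "B' \<in> pullback Z \<psi> G r" "pb A \<in> pullback Z \<psi> G (r - \<tau>)" "pb A \<subseteq> B'"
      by (auto simp: pullback_def)
    then show "B' \<in> ?L" using P.prune_eq[OF assms] by blast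
  qed
qed

end

subsection \<open>Barcodes\<close>

text \<open>If each member of \<open>N\<close> missed a point of \<open>B\<close>, the least and the
  greatest of these finitely many points would share a member, whose convexity brings in its own
  missed point.\<close>

lemma exists_interval_superset:
  fixes N :: "real set multiset"
  assumes iv: "\<And>B. B \<in># N \<Longrightarrow> is_interval B" and "B \<noteq> {}"
    and cover: "\<And>r r'. r \<in> B \<Longrightarrow> r' \<in> B \<Longrightarrow> r \<le> r' \<Longrightarrow> \<exists>C. C \<in># N \<and> r \<in> C \<and> r' \<in> C"
  shows "\<exists>C. C \<in># N \<and> B \<subseteq> C"
proof (rule ccontr)
  assume "\<not> ?thesis"
  then have "\<forall>C\<in>set_mset N. \<exists>x. x \<in> B \<and> x \<notin> C" by blast
  then obtain x where x: "\<And>C. C \<in># N \<Longrightarrow> x C \<in> B \<and> x C \<notin> C" by metis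
  obtain b where b: "b \<in> B" using \<open>B \<noteq> {}\<close> by blast
  \<comment> \<open>The point \<open>b\<close> keeps \<open>S\<close> non-empty when
    \<open>N\<close> is empty.\<close>
  define S where "S = insert b (x ` set_mset N)"
  have S: "finite S" "S \<noteq> {}" "S \<subseteq> B" using x b by (auto simp: S_def)
  have "Min S \<in> B" "Max S \<in> B" "Min S \<le> Max S"
    using S Min_in Max_in by (auto simp: subset_iff)
  then obtain C where C: "C \<in># N" "Min S \<in> C" "Max S \<in> C" using cover by blast
  have "x C \<in> S" using C by (simp add: S_def)
  then have "Min S \<le> x C" "x C \<le> Max S" using S by auto
  then have "x C \<in> C" using mem_is_interval_1_I[OF iv[OF C(1)] C(2,3)] by blast
  then show False using x C by blast
qed

text \<open>An inclusion-maximal interval of \<open>M + N\<close> that occurs in one multiset is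
  contained in an interval of the other, and maximality makes them equal. Removing it from both
  sides changes both counts alike.\<close>

lemma interval_multiset_eqI:
  fixes M N :: "real set multiset"
  assumes "\<And>B. B \<in># M \<Longrightarrow> is_interval B \<and> B \<noteq> {}" "\<And>B. B \<in># N \<Longrightarrow> is_interval B \<and> B \<noteq> {}"
    and "\<And>r r'. r \<le> r' \<Longrightarrow> size {#B \<in># M. r \<in> B \<and> r' \<in> B#} = size {#B \<in># N. r \<in> B \<and> r' \<in> B#}"
  shows "M = N"
  using assms
proof (induction "size M" arbitrary: M N rule: less_induct)
  case less
  have transfer: "\<exists>C. C \<in># L' \<and> B \<subseteq> C"
    if L': "\<And>B. B \<in># L' \<Longrightarrow> is_interval B" and B: "B \<in># L" "B \<noteq> {}"
      and eq: "\<And>r r'. r \<le> r' \<Longrightarrow> size {#B \<in># L. r \<in> B \<and> r' \<in> B#} = size {#B \<in># L'. r \<in> B \<and> r' \<in> B#}"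
    for L L' :: "real set multiset" and B
  proof (rule exists_interval_superset[OF L' B(2)])
    fix r r' assume r: "r \<in> B" "r' \<in> B" "r \<le> r'"
    then have "B \<in># {#B \<in># L. r \<in> B \<and> r' \<in> B#}" using B by simp
    then have "size {#B \<in># L. r \<in> B \<and> r' \<in> B#} \<noteq> 0" by (metis multi_member_split size_add_mset nat.distinct(2))
    then have "size {#B \<in># L'. r \<in> B \<and> r' \<in> B#} \<noteq> 0" using eq r by simp
    then obtain C where "C \<in># {#B \<in># L'. r \<in> B \<and> r' \<in> B#}" by (metis multiset_nonemptyE size_empty)
    then show "\<exists>C. C \<in># L' \<and> r \<in> C \<and> r' \<in> C" by auto
  qed
  show ?case
  proof (cases "M + N = {#}")
    case False
    then have "finite (set_mset (M + N))" "set_mset (M + N) \<noteq> {}" by auto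
    then obtain B where B: "B \<in># M + N" and max: "\<And>C. C \<in># M + N \<Longrightarrow> B \<subseteq> C \<Longrightarrow> B = C"
      using finite_has_maximal by metis
    have "B \<in># M \<and> B \<in># N"
    proof (cases "B \<in># M")
      case True
      then obtain C where "C \<in># N" "B \<subseteq> C" using transfer[of N B M] less.prems by metis
      then show ?thesis using max True by (metis union_iff)
    next
      case False
      then have BN: "B \<in># N" using B by simp
      then obtain C where "C \<in># M" "B \<subseteq> C" using transfer[of M B N] less.prems by metis
      then show ?thesis using max BN by (metis union_iff)
    qed
    then obtain M' N' where eq: "M = add_mset B M'" "N = add_mset B N'" by (metis multi_member_split)
    have "M' = N'"
    proof (rule less.hyps)
      show "size M' < size M" using eq by simp
      show "size {#B \<in># M'. r \<in> B \<and> r' \<in> B#} = size {#B \<in># N'. r \<in> B \<and> r' \<in> B#}" if "r \<le> r'" for r r'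
        using less.prems(3)[OF that] unfolding eq by (simp split: if_splits)
    qed (use less.prems eq in auto)
    then show ?thesis using eq by simp
  qed simp
qed

lemma barcode_unique:
  assumes "is_barcode H M" "is_barcode H N"
  shows "M = N"
  by (rule interval_multiset_eqI) (use assms in \<open>auto simp: is_barcode_def\<close>)

lemma barcode_eq: "is_barcode H M \<Longrightarrow> barcode H = M"
  unfolding barcode_def using barcode_unique by (metis the_equality)

text \<open>Several elements of \<open>S\<close> may have the same set, so an injective ranking by
  decreasing size needs a tie-break.\<close>

lemma exists_linear_refinement:
  fixes b :: "'i \<Rightarrow> 'j set"
  assumes "finite S" and total: "\<And>x y. x \<in> S \<Longrightarrow> y \<in> S \<Longrightarrow> b x \<subseteq> b y \<or> b y \<subseteq> b x"
  shows "\<exists>K::'i \<Rightarrow> nat. inj_on K S \<and> (\<forall>x\<in>S. \<forall>y\<in>S. K x < K y \<longrightarrow> b y \<subseteq> b x)"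
proof -
  define n where "n = card S"
  obtain f where f: "bij_betw f S {0..<n}" using ex_bij_betw_finite_nat[OF assms(1)] n_def by blast
  then have fn: "f x < n" if "x \<in> S" for x using that by (auto dest: bij_betwE)
  define k where "k x = card {y \<in> S. b x \<subset> b y}" for x
  \<comment> \<open>A two-digit number in base \<open>n\<close>: the age rank comes first, and the
    numbering \<open>f\<close>, with values below \<open>n\<close>, only breaks ties.\<close>
  define K where "K x = k x * n + f x" for x
  have "inj_on K S"
  proof (rule inj_onI)
    fix x y assume xy: "x \<in> S" "y \<in> S" "K x = K y"
    have "K x mod n = f x" "K y mod n = f y" unfolding K_def
      using fn[OF xy(1)] fn[OF xy(2)] by simp_all
    then show "x = y" using xy f by (metis bij_betw_imp_inj_on inj_onD)
  qed
  moreover have "b y \<subseteq> b x" if xy: "x \<in> S" "y \<in> S" "K x < K y" for x y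
  proof (rule ccontr)
    assume "\<not> b y \<subseteq> b x"
    then have "b x \<subset> b y" using total xy by blast
    then have "{z \<in> S. b y \<subset> b z} \<subset> {z \<in> S. b x \<subset> b z}" using xy by blast
    then have "k y < k x" unfolding k_def using assms(1) by (intro psubset_card_mono) auto
    then have "(k y + 1) * n \<le> k x * n" by (intro mult_le_mono1) simp
    then have "K y < K x" using fn[OF xy(2)] by (simp add: K_def)
    then show False using xy by simp
  qed
  ultimately show ?thesis by blast
qed

context hc
begin

text \<open>Follows the branch of \<open>c\<close> past the end of its life, into the clusters it
  has merged with.\<close>

definition reach :: "'a pcluster \<Rightarrow> real \<Rightarrow> 'a set \<Rightarrow> bool" where
  "reach c r B \<longleftrightarrow> B \<in> G r \<and> (\<exists>p C. (p, C) \<in> c \<and> p \<le> r \<and> C \<subseteq> B)"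

text \<open>A birth time could be minus infinity or fail to be attained; up-sets compare ages in all
  cases.\<close>

definition born :: "'a pcluster \<Rightarrow> real set" where
  "born c = {r. \<exists>p\<in>life c. p \<le> r}"

text \<open>A merger with a leaf that is later in \<open>K\<close> ends the life of \<open>c\<close>
  but not its bar; only the arrival of an earlier leaf ends the bar.\<close>

definition bar :: "('a pcluster \<Rightarrow> nat) \<Rightarrow> 'a pcluster \<Rightarrow> real set" where
  "bar K c = {r. \<exists>B. reach c r B \<and> (\<forall>d\<in>leaves G. K d < K c \<longrightarrow> \<not> reach d r B)}"

lemma reach_unique:
  assumes "c \<in> leaves G" "reach c r B" "reach c r B'"
  shows "B = B'"
proof -
  obtain p C p' C' where "B \<in> G r" "B' \<in> G r" "(p, C) \<in> c" "(p', C') \<in> c" "C \<subseteq> B" "C' \<subseteq> B'"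
    using assms unfolding reach_def by blast
  moreover from this have "C \<inter> C' \<noteq> {}" using leaf_overlap[OF assms(1)] by blast
  ultimately show ?thesis using same_level[of B r B'] by blast
qed

lemma reach_up:
  assumes "reach c r A" "B \<in> G s" "r \<le> s" "A \<subseteq> B"
  shows "reach c s B"
proof -
  obtain p C where "(p, C) \<in> c" "p \<le> r" "C \<subseteq> A" using assms(1) unfolding reach_def by blast
  then have "(p, C) \<in> c \<and> p \<le> s \<and> C \<subseteq> B" using assms by auto
  then show ?thesis unfolding reach_def using assms(2) by blast
qed

lemma reach_image:
  assumes "reach c r A" "r \<le> s"
  shows "\<exists>B. reach c s B \<and> A \<subseteq> B"
proof -
  have "A \<in> G r" using assms by (simp add: reach_def)
  then obtain B where "B \<in> G s" "A \<subseteq> B" using up assms(2) by blast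
  then show ?thesis using reach_up[OF assms(1)] assms(2) by blast
qed

lemma reach_born: "reach c r B \<Longrightarrow> r \<in> born c"
  by (force simp: reach_def born_def life_def)

lemma born_reach:
  assumes "c \<in> leaves G" "r \<in> born c"
  shows "\<exists>B. reach c r B"
proof -
  obtain p C where C: "(p, C) \<in> c" "p \<le> r" using assms(2) by (auto simp: born_def life_def)
  then have "reach c p C" using leaf_level[OF assms(1) C(1)] by (auto simp: reach_def)
  then show ?thesis using reach_image C(2) by blast
qed

lemma born_total: "born c \<subseteq> born d \<or> born d \<subseteq> born c"
  unfolding born_def by (smt (verit) Collect_mono order_trans linear mem_Collect_eq)

text \<open>An earlier leaf that has joined the branch stays with it, so a bar that has stopped
  cannot resume.\<close>

lemma is_interval_bar: 
  assumes "c \<in> leaves G"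
  shows "is_interval (bar K c)"
  unfolding is_interval_1
proof (intro ballI allI impI)
  fix a b x assume a: "a \<in> bar K c" and b: "b \<in> bar K c" and "a \<le> x \<and> x \<le> b"
  then have x: "a \<le> x" "x \<le> b" by auto
  obtain A where A: "reach c a A" using a unfolding bar_def by blast
  obtain B where B: "reach c x B" using reach_image[OF A x(1)] by blast
  have "\<not> reach d x B" if d: "d \<in> leaves G" "K d < K c" for d
  proof
    assume "reach d x B"
    obtain B' where B': "reach c b B'" "B \<subseteq> B'" using reach_image[OF B x(2)] by blast
    have "B' \<in> G b" using B' by (simp add: reach_def)
    then have "reach d b B'" using reach_up[OF \<open>reach d x B\<close> _ x(2) B'(2)] by blast
    moreover obtain B2 where "reach c b B2" "\<not> reach d b B2" using b d unfolding bar_def by blast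
    ultimately show False using reach_unique[OF assms B'(1)] by blast
  qed
  then show "x \<in> bar K c" using B unfolding bar_def by blast
qed

lemma bar_nonempty:
  assumes c: "c \<in> leaves G"
  shows "bar K c \<noteq> {}"
proof -
  obtain p C where C: "(p, C) \<in> c" using leaf_nonempty[OF c] by blast
  have Cp: "C \<in> G p" using leaf_level[OF c C] .
  have "\<not> reach d p C" if d: "d \<in> leaves G" "K d < K c" for d
  proof
    assume "reach d p C"
    then obtain q D where D: "(q, D) \<in> d" "D \<subseteq> C" unfolding reach_def by blast
    then have "D \<inter> C \<noteq> {}" using nonempty[OF leaf_level[OF d(1) D(1)]] by blast
    then have "d = c" using leaf_eq[OF d(1) c D(1) C] by blast
    then show False using d(2) by simp
  qed
  moreover have "reach c p C" using C Cp by (auto simp: reach_def)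
  ultimately show ?thesis unfolding bar_def by blast
qed

text \<open>The elder rule: where branches meet, only the bar of the one that comes first in the
  order \<open>K\<close> continues, and \<open>K\<close> lists the leaves by age.\<close>

lemma card_bars:
  assumes root: "rooted G" and inj: "inj_on K (leaves G)"
    and K: "\<And>c d. c \<in> leaves G \<Longrightarrow> d \<in> leaves G \<Longrightarrow> K c < K d \<Longrightarrow> born d \<subseteq> born c"
    and rs: "r \<le> s"
  shows "card (hc_map G r s ` G r) = card {c \<in> leaves G. r \<in> bar K c \<and> s \<in> bar K c}"
proof -
  define h where "h c = (THE B. reach c s B)" for c
  have h: "h c = B" if "c \<in> leaves G" "reach c s B" for c B
    unfolding h_def using reach_unique[OF that(1)] that(2) by (metis the_equality)
  have "bij_betw h {c \<in> leaves G. r \<in> bar K c \<and> s \<in> bar K c} {B \<in> G s. \<exists>A\<in>G r. A \<subseteq> B}"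
  proof (rule bij_betw_imageI)
    show "inj_on h {c \<in> leaves G. r \<in> bar K c \<and> s \<in> bar K c}"
    proof (rule inj_onI; clarify)
      fix c d assume c: "c \<in> leaves G" "s \<in> bar K c" and d: "d \<in> leaves G" "s \<in> bar K d" and eq: "h c = h d"
      obtain B where B: "reach c s B" "\<And>e. e \<in> leaves G \<Longrightarrow> K e < K c \<Longrightarrow> \<not> reach e s B"
        using c(2) unfolding bar_def by blast
      obtain D where D: "reach d s D" "\<And>e. e \<in> leaves G \<Longrightarrow> K e < K d \<Longrightarrow> \<not> reach e s D"
        using d(2) unfolding bar_def by blast
      have "B = D" using h[OF c(1) B(1)] h[OF d(1) D(1)] eq by simp
      then have "\<not> K d < K c" "\<not> K c < K d" using B D c d by blast+
      then show "c = d" using inj_onD[OF inj _ c(1) d(1)] by linarith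
    qed
    show "h ` {c \<in> leaves G. r \<in> bar K c \<and> s \<in> bar K c} = {B \<in> G s. \<exists>A\<in>G r. A \<subseteq> B}"
    proof (intro equalityI subsetI)
      fix B assume "B \<in> h ` {c \<in> leaves G. r \<in> bar K c \<and> s \<in> bar K c}"
      then obtain c where c: "c \<in> leaves G" "r \<in> bar K c" "B = h c" by blast
      obtain A where A: "reach c r A" using c(2) unfolding bar_def by blast
      obtain B' where B': "reach c s B'" "A \<subseteq> B'" using reach_image[OF A rs] by blast
      then have "B = B'" using h c by blast
      then show "B \<in> {B \<in> G s. \<exists>A\<in>G r. A \<subseteq> B}" using A B' by (auto simp: reach_def)
    next
      fix B assume "B \<in> {B \<in> G s. \<exists>A\<in>G r. A \<subseteq> B}"
      then obtain A where B: "B \<in> G s" and A: "A \<in> G r" "A \<subseteq> B" by blast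
      \<comment> \<open>The \<open>K\<close>-least candidate may reach at level \<open>r\<close> a
        cluster other than \<open>A\<close>, but that cluster lies in \<open>B\<close> too. A leaf
        even earlier in \<open>K\<close> that reaches \<open>B\<close> is born by \<open>r\<close>
        as well, since \<open>K\<close> respects age, so it would itself be a candidate.\<close>
      define P where "P c \<longleftrightarrow> c \<in> leaves G \<and> r \<in> born c \<and> reach c s B" for c
      obtain c0 p C where c0: "c0 \<in> leaves G" "(p, C) \<in> c0" "p \<le> r" "C \<subseteq> A"
        using leaf_below[OF root A(1)] by blast
      have "reach c0 r A" using c0 A by (auto simp: reach_def)
      then have "P c0" using reach_born reach_up[OF _ B rs A(2)] c0(1) by (auto simp: P_def)
      then obtain c where c: "P c" "\<And>d. P d \<Longrightarrow> K c \<le> K d" using ex_has_least_nat[of P c0 K] by blast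
      have cl: "c \<in> leaves G" and cr: "r \<in> born c" and cs: "reach c s B" using c(1) by (auto simp: P_def)
      obtain A' where A': "reach c r A'" using born_reach[OF cl cr] by blast
      have A'B: "A' \<subseteq> B" using reach_image[OF A' rs] reach_unique[OF cl cs] by blast
      have "\<not> reach d r A'" if d: "d \<in> leaves G" "K d < K c" for d
      proof
        assume "reach d r A'"
        then have "P d" using reach_up[OF _ B rs A'B] reach_born d(1) by (auto simp: P_def)
        then show False using c(2) d(2) by fastforce
      qed
      then have 1: "r \<in> bar K c" using A' unfolding bar_def by blast
      have "\<not> reach d s B" if d: "d \<in> leaves G" "K d < K c" for d
      proof
        assume "reach d s B"
        moreover have "r \<in> born d" using K[OF d(1) cl d(2)] cr by blast
        ultimately have "P d" using d(1) by (simp add: P_def)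
        then show False using c(2) d(2) by fastforce
      qed
      then have 2: "s \<in> bar K c" using cs unfolding bar_def by blast
      show "B \<in> h ` {c \<in> leaves G. r \<in> bar K c \<and> s \<in> bar K c}" using 1 2 cl h[OF cl cs] by blast
    qed
  qed
  from bij_betw_same_card[OF this] show ?thesis unfolding hc_map_image[OF rs] by (rule sym)
qed

lemma barcode_exists:
  assumes root: "rooted G" and fin: "finite (leaves G)"
  shows "\<exists>M. is_barcode G M \<and> size M = card (leaves G)"
proof -
  from exists_linear_refinement[OF fin, of born, OF born_total]
  obtain K :: "'a pcluster \<Rightarrow> nat" where K': "inj_on K (leaves G) \<and>
    (\<forall>c\<in>leaves G. \<forall>d\<in>leaves G. K c < K d \<longrightarrow> born d \<subseteq> born c)" by (rule exE)
  then have inj: "inj_on K (leaves G)"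
    and K: "\<And>c d. c \<in> leaves G \<Longrightarrow> d \<in> leaves G \<Longrightarrow> K c < K d \<Longrightarrow> born d \<subseteq> born c"
    by auto
  define M where "M = image_mset (bar K) (mset_set (leaves G))"
  have "is_barcode G M"
    unfolding is_barcode_def
  proof (intro conjI ballI allI impI)
    fix B assume "B \<in># M"
    then obtain c where "c \<in> leaves G" "B = bar K c" using fin by (auto simp: M_def)
    then show "is_interval B" "B \<noteq> {}" using is_interval_bar bar_nonempty by auto
  next
    fix r s :: real assume rs: "r \<le> s"
    show "card (hc_map G r s ` G r) = size {#B \<in># M. r \<in> B \<and> s \<in> B#}"
      using card_bars[OF root inj K rs] fin by (simp add: M_def filter_mset_image_mset)
  qed
  moreover have "size M = card (leaves G)" by (simp add: M_def)
  ultimately show ?thesis by blast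
qed

text \<open>By \<open>prune_prune\<close>, the image at \<open>s\<close> of the pruned clusters of
  level \<open>r\<close> is the image of all clusters of level \<open>r - \<tau>\<close>. So the
  rank between \<open>r\<close> and \<open>s\<close> becomes the rank of \<open>G\<close> between
  \<open>r - \<tau>\<close> and \<open>s\<close>. Bars disjoint from their translate are filtered
  out, as a barcode admits no empty interval.\<close>

lemma is_barcode_prune:
  assumes M: "is_barcode G M" and \<tau>: "0 \<le> \<tau>"
  shows "is_barcode (prune \<tau> G)
    (image_mset (\<lambda>B. {x \<in> B. x - \<tau> \<in> B}) {#B \<in># M. \<exists>x\<in>B. x - \<tau> \<in> B#})"
  unfolding is_barcode_def
proof (intro conjI ballI allI impI)
  have iv: "is_interval B" if "B \<in># M" for B using M that by (simp add: is_barcode_def)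
  fix B' assume "B' \<in># image_mset (\<lambda>B. {x \<in> B. x - \<tau> \<in> B}) {#B \<in># M. \<exists>x\<in>B. x - \<tau> \<in> B#}"
  then obtain B where B: "B \<in># M" "\<exists>x\<in>B. x - \<tau> \<in> B" "B' = {x \<in> B. x - \<tau> \<in> B}" by auto
  show "B' \<noteq> {}" using B by blast
  show "is_interval B'"
    using iv[OF B(1)] unfolding B(3) is_interval_1 by (smt (verit) mem_Collect_eq)
next
  have iv: "is_interval B" if "B \<in># M" for B using M that by (simp add: is_barcode_def)
  fix r s :: real assume rs: "r \<le> s"
  have "hc_map (prune \<tau> G) r s ` prune \<tau> G r = prune (s - r) (prune \<tau> G) s"
    by (simp add: prune_def)
  also have "\<dots> = prune (\<tau> + (s - r)) G s" using prune_prune[OF \<tau>] rs by simp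
  also have "\<dots> = hc_map G (r - \<tau>) s ` G (r - \<tau>)" by (simp add: prune_def)
  finally have "card (hc_map (prune \<tau> G) r s ` prune \<tau> G r) = card (hc_map G (r - \<tau>) s ` G (r - \<tau>))"
    by simp
  also have "\<dots> = size {#B \<in># M. r - \<tau> \<in> B \<and> s \<in> B#}" using M rs \<tau> by (simp add: is_barcode_def)
  also have "{#B \<in># M. r - \<tau> \<in> B \<and> s \<in> B#} =
    {#B \<in># M. (\<exists>x\<in>B. x - \<tau> \<in> B) \<and> r \<in> {x \<in> B. x - \<tau> \<in> B} \<and> s \<in> {x \<in> B. x - \<tau> \<in> B}#}"
  proof (rule filter_mset_cong[OF refl])
    fix B assume B: "B \<in># M"
    show "(r - \<tau> \<in> B \<and> s \<in> B) \<longleftrightarrow>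
      ((\<exists>x\<in>B. x - \<tau> \<in> B) \<and> r \<in> {x \<in> B. x - \<tau> \<in> B} \<and> s \<in> {x \<in> B. x - \<tau> \<in> B})"
      using mem_is_interval_1_I[OF iv[OF B], of "r - \<tau>" s r]
        mem_is_interval_1_I[OF iv[OF B], of "r - \<tau>" s "s - \<tau>"] rs \<tau> by auto
  qed
  finally show "card (hc_map (prune \<tau> G) r s ` prune \<tau> G r) =
    size {#B' \<in># image_mset (\<lambda>B. {x \<in> B. x - \<tau> \<in> B}) {#B \<in># M. \<exists>x\<in>B. x - \<tau> \<in> B#}. r \<in> B' \<and> s \<in> B'#}"
    by (simp add: filter_mset_image_mset filter_filter_mset conj_commute)
qed

text \<open>The elder rule gives the pruned clustering a barcode with one bar per leaf; by
  uniqueness it is the one cut out of \<open>M\<close>.\<close>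

lemma card_leaves_prune:
  assumes M: "is_barcode G M" and \<tau>: "0 \<le> \<tau>"
    and "rooted (prune \<tau> G)" "finite (leaves (prune \<tau> G))"
  shows "card (leaves (prune \<tau> G)) = size {#B \<in># M. \<exists>x\<in>B. x - \<tau> \<in> B#}"
proof -
  interpret P: hc X "prune \<tau> G" using hc_prune[OF \<tau>] .
  obtain M' where "is_barcode (prune \<tau> G) M'" "size M' = card (leaves (prune \<tau> G))"
    using P.barcode_exists assms by blast
  then show ?thesis using barcode_unique[OF is_barcode_prune[OF M \<tau>]] by fastforce
qed

end

subsection \<open>Prominence\<close>

lemma size_filter_mset_mono:
  "(\<And>x. x \<in># M \<Longrightarrow> P x \<Longrightarrow> Q x) \<Longrightarrow> size (filter_mset P M) \<le> size (filter_mset Q M)"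
  by (induction M) (auto simp: le_Suc_eq)

text \<open>An upward closed \<open>P\<close> selects an initial segment of a decreasing list.
  Falsity at \<open>0\<close> makes the default beyond the end agree with the count.\<close>

lemma nth_sorted_iff:
  fixes ls :: "'b::{linorder, zero} list"
  assumes "sorted_wrt (\<ge>) ls" "\<And>x y. P x \<Longrightarrow> x \<le> y \<Longrightarrow> P y" "\<not> P 0"
  shows "P (if i < length ls then ls ! i else 0) \<longleftrightarrow> i < length (filter P ls)"
  using assms(1)
proof (induction ls arbitrary: i)
  case (Cons x xs)
  have IH: "P (if j < length xs then xs ! j else 0) \<longleftrightarrow> j < length (filter P xs)" for j
    using Cons by simp
  show ?case
  proof (cases "P x")
    case True
    show ?thesis
    proof (cases i)
      case (Suc j)
      then show ?thesis using IH[of j] True by (simp split: if_splits)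
    qed (simp add: True)
  next
    case False
    have no: "\<not> P y" if "y \<in> set (x # xs)" for y
    proof
      assume "P y"
      moreover have "y \<le> x" using Cons.prems that by auto
      ultimately show False using assms(2) False by blast
    qed
    then have "filter P (x # xs) = []" by (simp add: filter_empty_conv)
    moreover have "\<not> P (if i < length (x # xs) then (x # xs) ! i else 0)"
      using no[OF nth_mem, of i] assms(3) by presburger
    ultimately show ?thesis by simp
  qed
qed (use assms in auto)

lemma prominence_fin_iff:
  assumes "\<And>x y. P x \<Longrightarrow> x \<le> y \<Longrightarrow> P y" "\<not> P 0"
  shows "P (prominence_fin H i) \<longleftrightarrow> i < size {#B \<in># barcode H. P (emeasure lborel B)#}"
proof -
  define N where "N = image_mset (emeasure lborel) (barcode H)"
  define ls where "ls = rev (sorted_list_of_multiset N)"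
  have "sorted_wrt (\<ge>) ls" by (simp add: ls_def sorted_wrt_rev)
  then have "P (prominence_fin H i) \<longleftrightarrow> i < length (filter P ls)"
    using nth_sorted_iff[of ls P i] assms unfolding prominence_fin_def Let_def ls_def N_def by blast
  also have "length (filter P ls) = size (filter_mset P N)"
    by (metis ls_def mset_filter mset_rev mset_sorted_list_of_multiset size_mset)
  also have "\<dots> = size {#B \<in># barcode H. P (emeasure lborel B)#}"
    by (simp add: N_def filter_mset_image_mset)
  finally show ?thesis .
qed

text \<open>Without such a pair all differences stay below \<tau>, so \<open>B\<close> fits into an
  interval of length at most \<tau>. At length exactly \<tau> the endpoints decide, hence the strict
  bound here and the weak one in \<open>shift_imp_emeasure\<close>.\<close>

lemma interval_has_shift:
  fixes B :: "real set"
  assumes B: "is_interval B" and \<tau>: "0 \<le> \<tau>" and less: "ennreal \<tau> < emeasure lborel B"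
  shows "\<exists>x\<in>B. x - \<tau> \<in> B"
proof (rule ccontr)
  assume no: "\<not> ?thesis"
  have diff: "x - y < \<tau>" if "x \<in> B" "y \<in> B" for x y
  proof (rule ccontr)
    assume "\<not> x - y < \<tau>"
    then have "x - \<tau> \<in> B" using mem_is_interval_1_I[OF B that(2,1), of "x - \<tau>"] \<tau> by simp
    then show False using no that by blast
  qed
  have ne: "B \<noteq> {}" using less by auto
  then obtain b where b: "b \<in> B" by blast
  have "bdd_above B" using diff[OF _ b] by (intro bdd_aboveI[of _ "b + \<tau>"]) force
  moreover have "bdd_below B" using diff[OF b] by (intro bdd_belowI[of _ "b - \<tau>"]) force
  ultimately have sub: "B \<subseteq> {Inf B..Sup B}" by (auto intro: cInf_lower cSup_upper)
  have "Sup B - \<tau> \<le> y" if "y \<in> B" for y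
    using cSup_least[OF ne, of "y + \<tau>"] diff[OF _ that] by force
  then have "Sup B - \<tau> \<le> Inf B" using cInf_greatest[OF ne] by blast
  then have le: "Sup B - Inf B \<le> \<tau>" by simp
  have "Inf B \<le> Sup B" using sub b by force
  have "emeasure lborel B \<le> emeasure lborel {Inf B..Sup B}" by (rule emeasure_mono[OF sub]) simp
  also have "\<dots> \<le> ennreal \<tau>" using le \<open>Inf B \<le> Sup B\<close> by (simp add: ennreal_leI)
  finally show False using less by simp
qed

lemma shift_imp_emeasure:
  fixes B :: "real set"
  assumes B: "is_interval B" and \<tau>: "0 \<le> \<tau>" and x: "x \<in> B" "x - \<tau> \<in> B"
  shows "ennreal \<tau> \<le> emeasure lborel B"
proof -
  have "{x - \<tau>..x} \<subseteq> B" using mem_is_interval_1_I[OF B x(2,1)] by auto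
  moreover have "B \<in> sets lborel" using real_interval_borel_measurable[OF B] by simp
  ultimately have "emeasure lborel {x - \<tau>..x} \<le> emeasure lborel B" by (rule emeasure_mono)
  then show ?thesis using \<tau> by simp
qed

section \<open>Prominence as a supremum over leaf counts\<close>

locale ess_finite_hc = hc X H for X :: "'a set" and H +
  assumes ess_finite: "essentially_finite H"
begin

abbreviation num_leaves :: "real \<Rightarrow> nat" where
  "num_leaves \<tau> \<equiv> card (leaves (prune \<tau> H))"

lemma finite_PC: "0 < \<tau> \<Longrightarrow> finite (PC (prune \<tau> H))"
  using ess_finite by (simp add: essentially_finite_def hc_finite_def)

lemma rooted_prune: "0 < \<tau> \<Longrightarrow> rooted (prune \<tau> H)"
  using hc.rooted_if_finite[OF hc_prune finite_PC] by simp

lemma finite_leaves: "0 < \<tau> \<Longrightarrow> finite (leaves (prune \<tau> H))"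
  using finite_PC[of \<tau>] by (simp add: leaves_def)

lemma is_barcode_barcode:
  assumes "0 < \<sigma>"
  shows "is_barcode (prune \<sigma> H) (barcode (prune \<sigma> H))"
    and "size (barcode (prune \<sigma> H)) = num_leaves \<sigma>"
proof -
  interpret P: hc X "prune \<sigma> H" using hc_prune[of \<sigma>] assms by simp
  obtain M where "is_barcode (prune \<sigma> H) M" "size M = num_leaves \<sigma>"
    using P.barcode_exists[OF rooted_prune[OF assms] finite_leaves[OF assms]] by blast
  then show "is_barcode (prune \<sigma> H) (barcode (prune \<sigma> H))"
    and "size (barcode (prune \<sigma> H)) = num_leaves \<sigma>"
    using barcode_eq by auto
qed

lemma num_leaves_eq:
  assumes "0 < \<sigma>" "0 \<le> \<tau>"
  shows "num_leaves (\<sigma> + \<tau>) = size {#B \<in># barcode (prune \<sigma> H). \<exists>x\<in>B. x - \<tau> \<in> B#}"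
proof -
  interpret P: hc X "prune \<sigma> H" using hc_prune[of \<sigma>] assms by simp
  have eq: "prune \<tau> (prune \<sigma> H) = prune (\<sigma> + \<tau>) H" using prune_prune assms by simp
  have "0 < \<sigma> + \<tau>" using assms by simp
  then show ?thesis
    using P.card_leaves_prune[OF is_barcode_barcode(1)[OF assms(1)] assms(2)]
      rooted_prune[of "\<sigma> + \<tau>"] finite_leaves[of "\<sigma> + \<tau>"] unfolding eq by blast
qed

lemma num_leaves_antimono:
  assumes "0 < \<sigma>" "\<sigma> \<le> \<tau>"
  shows "num_leaves \<tau> \<le> num_leaves \<sigma>"
proof -
  have "num_leaves \<tau> = size {#B \<in># barcode (prune \<sigma> H). \<exists>x\<in>B. x - (\<tau> - \<sigma>) \<in> B#}"
    using num_leaves_eq[of \<sigma> "\<tau> - \<sigma>"] assms by simp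
  also have "\<dots> \<le> size (barcode (prune \<sigma> H))" by (rule size_filter_mset_lesseq)
  finally show ?thesis using is_barcode_barcode(2)[OF assms(1)] by simp
qed

lemma less_num_leaves_if:
  assumes "0 < \<sigma>" "0 \<le> t" "ennreal t < prominence_fin (prune \<sigma> H) i"
  shows "i < num_leaves (\<sigma> + t)"
proof -
  have "i < size {#B \<in># barcode (prune \<sigma> H). ennreal t < emeasure lborel B#}"
    using prominence_fin_iff[of "\<lambda>x. ennreal t < x" "prune \<sigma> H" i] assms(3) by auto
  also have "\<dots> \<le> size {#B \<in># barcode (prune \<sigma> H). \<exists>x\<in>B. x - t \<in> B#}"
  proof (rule size_filter_mset_mono)
    fix B assume "B \<in># barcode (prune \<sigma> H)"
    then have "is_interval B" using is_barcode_barcode(1)[OF assms(1)] by (simp add: is_barcode_def)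
    then show "ennreal t < emeasure lborel B \<Longrightarrow> \<exists>x\<in>B. x - t \<in> B"
      by (rule interval_has_shift[OF _ assms(2)])
  qed
  finally show ?thesis using num_leaves_eq[OF assms(1,2)] by simp
qed

lemma prominence_fin_ge_if:
  assumes "0 < \<sigma>" "0 < t" "i < num_leaves (\<sigma> + t)"
  shows "ennreal t \<le> prominence_fin (prune \<sigma> H) i"
proof -
  have "i < size {#B \<in># barcode (prune \<sigma> H). \<exists>x\<in>B. x - t \<in> B#}"
    using num_leaves_eq[of \<sigma> t] assms by simp
  also have "\<dots> \<le> size {#B \<in># barcode (prune \<sigma> H). ennreal t \<le> emeasure lborel B#}"
  proof (rule size_filter_mset_mono)
    fix B assume "B \<in># barcode (prune \<sigma> H)"
    then have "is_interval B" using is_barcode_barcode(1)[OF assms(1)] by (simp add: is_barcode_def)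
    then show "\<exists>x\<in>B. x - t \<in> B \<Longrightarrow> ennreal t \<le> emeasure lborel B"
      using shift_imp_emeasure[of B t] assms(2) by auto
  qed
  finally show ?thesis
    using prominence_fin_iff[of "\<lambda>x. ennreal t \<le> x" "prune \<sigma> H" i] assms(2) by auto
qed

text \<open>The bars of \<open>prune \<sigma> H\<close> that contain two points at distance
  \<open>t\<close> are as many as the leaves of \<open>prune (\<sigma> + t) H\<close>. So the
  \<open>i\<close>-th length is the supremum up to an error \<sigma>, uniformly in \<open>i\<close>.
  An empty supremum is \<open>0\<close>, in accordance with the zeros that follow the bars.\<close>

lemma is_prominence_Sup:
  "is_prominence H (\<lambda>i. Sup {ennreal \<tau> | \<tau>. 0 < \<tau> \<and> i < num_leaves \<tau>})" (is "is_prominence H ?P")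
  unfolding is_prominence_def
proof (intro allI impI)
  fix \<delta> :: real assume \<delta>: "0 < \<delta>"
  have "prominence_fin (prune \<sigma> H) i \<le> ?P i + ennreal \<delta> \<and> ?P i \<le> prominence_fin (prune \<sigma> H) i + ennreal \<delta>"
    if \<sigma>: "0 < \<sigma>" "\<sigma> < \<delta>" for \<sigma> i
  proof
    have "prominence_fin (prune \<sigma> H) i \<le> ?P i"
    proof (rule dense_le)
      fix x assume x: "x < prominence_fin (prune \<sigma> H) i"
      obtain t where t: "0 \<le> t" "x = ennreal t" using x by (cases x) auto
      then have "i < num_leaves (\<sigma> + t)" using less_num_leaves_if[OF \<sigma>(1)] x by blast
      then have "ennreal (\<sigma> + t) \<le> ?P i" using \<sigma>(1) t(1) by (intro Sup_upper) (auto intro!: exI[of _ "\<sigma> + t"])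
      moreover have "x \<le> ennreal (\<sigma> + t)" using t \<sigma> by (simp add: ennreal_leI)
      ultimately show "x \<le> ?P i" by order
    qed
    also have "\<dots> \<le> ?P i + ennreal \<delta>" by simp
    finally show "prominence_fin (prune \<sigma> H) i \<le> ?P i + ennreal \<delta>" .
    show "?P i \<le> prominence_fin (prune \<sigma> H) i + ennreal \<delta>"
    proof (rule Sup_least)
      fix y assume "y \<in> {ennreal \<tau> | \<tau>. 0 < \<tau> \<and> i < num_leaves \<tau>}"
      then obtain \<tau> where \<tau>: "y = ennreal \<tau>" "0 < \<tau>" "i < num_leaves \<tau>" by blast
      show "y \<le> prominence_fin (prune \<sigma> H) i + ennreal \<delta>"
      proof (cases "\<tau> \<le> \<sigma>")
        \<comment> \<open>The leaf count gives no bound here, but \<tau> is already below the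
          tolerance.\<close>
        case True
        then have "y \<le> ennreal \<delta>" using \<tau> \<sigma> by (simp add: ennreal_leI)
        also have "\<dots> \<le> prominence_fin (prune \<sigma> H) i + ennreal \<delta>" by simp
        finally show ?thesis .
      next
        case False
        then have "ennreal (\<tau> - \<sigma>) \<le> prominence_fin (prune \<sigma> H) i"
          using prominence_fin_ge_if[OF \<sigma>(1), of "\<tau> - \<sigma>" i] \<tau> by simp
        moreover have "y = ennreal (\<tau> - \<sigma>) + ennreal \<sigma>" using \<tau> \<sigma> False by (simp flip: ennreal_plus)
        moreover have "ennreal \<sigma> \<le> ennreal \<delta>" using \<sigma> by (simp add: ennreal_leI)
        ultimately show ?thesis by (simp add: add_mono)
      qed
    qed
  qed
  then show "\<forall>\<^sub>F \<sigma> in at_right 0. \<forall>i. prominence_fin (prune \<sigma> H) i \<le> ?P i + ennreal \<delta> \<and>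
      ?P i \<le> prominence_fin (prune \<sigma> H) i + ennreal \<delta>"
    unfolding eventually_at_right_field using \<delta> by blast
qed

text \<open>One pruning parameter close enough for both candidates links them. It exists because
  \<open>at_right 0\<close> is a proper filter.\<close>

lemma is_prominence_le:
  assumes "is_prominence H P" "is_prominence H Q"
  shows "P i \<le> Q i"
proof (rule ennreal_le_epsilon)
  fix e :: real assume e: "0 < e"
  have "\<forall>\<^sub>F \<tau> in at_right (0::real). P i \<le> prominence_fin (prune \<tau> H) i + ennreal (e / 2) \<and>
      prominence_fin (prune \<tau> H) i \<le> Q i + ennreal (e / 2)"
    using assms e unfolding is_prominence_def
    by (intro eventually_conj; elim allE[of _ "e / 2"]) (auto elim: eventually_mono)
  then have "\<exists>\<tau>. P i \<le> prominence_fin (prune \<tau> H) i + ennreal (e / 2) \<and>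
      prominence_fin (prune \<tau> H) i \<le> Q i + ennreal (e / 2)"
    using eventually_happens' trivial_limit_at_right_real by blast
  then obtain \<tau> where \<tau>: "P i \<le> prominence_fin (prune \<tau> H) i + ennreal (e / 2)"
    "prominence_fin (prune \<tau> H) i \<le> Q i + ennreal (e / 2)" by blast
  have "P i \<le> Q i + ennreal (e / 2) + ennreal (e / 2)"
    using \<tau> by (meson add_right_mono order_trans)
  also have "\<dots> = Q i + ennreal e" using e by (simp add: add.assoc flip: ennreal_plus)
  finally show "P i \<le> Q i + ennreal e" .
qed

lemma prominence_eq: "prominence H i = Sup {ennreal \<tau> | \<tau>. 0 < \<tau> \<and> i < num_leaves \<tau>}"
proof -
  have "prominence H = (\<lambda>i. Sup {ennreal \<tau> | \<tau>. 0 < \<tau> \<and> i < num_leaves \<tau>})"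
    unfolding prominence_def
    using is_prominence_Sup is_prominence_le by (intro the_equality ext antisym) blast+
  then show ?thesis by simp
qed

lemma prominence_ge: "0 < \<tau> \<Longrightarrow> i < num_leaves \<tau> \<Longrightarrow> ennreal \<tau> \<le> prominence H i"
  unfolding prominence_eq by (intro Sup_upper) blast

lemma less_num_leaves:
  assumes "0 < \<tau>" "ennreal \<tau> < prominence H i"
  shows "i < num_leaves \<tau>"
proof -
  obtain \<tau>' where \<tau>': "ennreal \<tau> < ennreal \<tau>'" "0 < \<tau>'" "i < num_leaves \<tau>'"
    using assms(2) unfolding prominence_eq less_Sup_iff by blast
  then have "\<tau> \<le> \<tau>'" using assms(1) by (simp add: ennreal_less_iff)
  then show ?thesis using num_leaves_antimono[OF assms(1)] \<tau>'(3) by (meson order_less_le_trans)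
qed

lemma num_leaves_in_gap:
  assumes "0 < \<tau>" "1 \<le> n" "prominence H n < ennreal \<tau>" "ennreal \<tau> < prominence H (n - 1)"
  shows "num_leaves \<tau> = n"
proof (rule antisym)
  show "num_leaves \<tau> \<le> n" using prominence_ge[OF assms(1), of n] assms(3) by (meson leD leI)
  show "n \<le> num_leaves \<tau>" using less_num_leaves[OF assms(1,4)] assms(2) by simp
qed

end

subsection \<open>Stability\<close>

text \<open>Levels above \<open>d\<close> transfer to \<open>\<tau> - d\<close> on the other side,
  and the additive constant absorbs the others. Thus pruning by \<open>0\<close>, where finiteness
  is not known, never occurs.\<close>

lemma prominence_le_if_num_leaves_le:
  assumes "ess_finite_hc X H" "ess_finite_hc Y E" "0 \<le> d"
    and le: "\<And>\<tau>. 0 < \<tau> \<Longrightarrow> card (leaves (prune (\<tau> + d) E)) \<le> card (leaves (prune \<tau> H))"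
  shows "prominence E i \<le> prominence H i + ennreal d"
  unfolding ess_finite_hc.prominence_eq[OF assms(2)]
proof (rule Sup_least)
  fix y assume "y \<in> {ennreal \<tau> | \<tau>. 0 < \<tau> \<and> i < card (leaves (prune \<tau> E))}"
  then obtain \<tau> where \<tau>: "y = ennreal \<tau>" "0 < \<tau>" "i < card (leaves (prune \<tau> E))" by blast
  show "y \<le> prominence H i + ennreal d"
  proof (cases "\<tau> \<le> d")
    case True
    then have "y \<le> ennreal d" using \<tau> by (simp add: ennreal_leI)
    also have "\<dots> \<le> prominence H i + ennreal d" by simp
    finally show ?thesis .
  next
    case False
    then have "i < card (leaves (prune (\<tau> - d) H))" using le[of "\<tau> - d"] \<tau> by simp
    then have "ennreal (\<tau> - d) \<le> prominence H i"
      using ess_finite_hc.prominence_ge[OF assms(1)] False by simp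
    moreover have "y = ennreal (\<tau> - d) + ennreal d" using \<tau> False assms(3) by (simp flip: ennreal_plus)
    ultimately show ?thesis by (simp add: add_right_mono)
  qed
qed

text \<open>In the bounded case both ends of the gap move by at most 2\<epsilon>, hence so does
  their midpoint. If one upper end is infinite, so is the other, and both levels sit at the same
  distance \<delta> above the lower ends.\<close>

lemma flattening_levels:
  fixes \<epsilon> \<delta> :: real
  assumes "0 \<le> \<epsilon>" "0 < \<delta>" and gap: "ennreal \<epsilon> < gapsize H n / 16"
    and EH: "\<And>i. prominence E i \<le> prominence H i + ennreal (2 * \<epsilon>)"
    and HE: "\<And>i. prominence H i \<le> prominence E i + ennreal (2 * \<epsilon>)"
  defines "s \<equiv> flattening_level \<delta> H n" and "t \<equiv> flattening_level \<delta> E n"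
  shows "0 < s" "prominence H n < ennreal s" "ennreal (s + 6 * \<epsilon>) < prominence H (n - 1)"
    and "0 < t" "prominence E n < ennreal t" "ennreal (t + 6 * \<epsilon>) < prominence E (n - 1)"
    and "\<bar>s - t\<bar> \<le> 2 * \<epsilon>" "gap E n \<noteq> {}"
proof -
  \<comment> \<open>An empty gap has size \<open>0\<close>, which the strict bound on \<epsilon>
    excludes.\<close>
  have pos: "0 < gapsize H n" using gap by (metis ennreal_zero_divide gr_zeroI not_less_zero)
  then have ne: "gap H n \<noteq> {}" by (auto simp: gapsize_def)
  then have less: "prominence H n < prominence H (n - 1)" by (auto simp: gap_def)
  have gap': "ennreal \<epsilon> < (prominence H (n - 1) - prominence H n) / 16"
    using gap ne by (simp add: gapsize_def)
  obtain a where a: "0 \<le> a" "prominence H n = ennreal a" using less by (cases "prominence H n") auto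
  obtain b where b: "0 \<le> b" "prominence E n = ennreal b"
    using EH[of n] a assms(1) by (cases "prominence E n") (auto simp: top_unique simp flip: ennreal_plus)
  have ab: "b \<le> a + 2 * \<epsilon>" "a \<le> b + 2 * \<epsilon>"
    using EH[of n] HE[of n] a b assms(1) by (simp_all flip: ennreal_plus)
  have "0 < s \<and> prominence H n < ennreal s \<and> ennreal (s + 6 * \<epsilon>) < prominence H (n - 1) \<and>
    0 < t \<and> prominence E n < ennreal t \<and> ennreal (t + 6 * \<epsilon>) < prominence E (n - 1) \<and> \<bar>s - t\<bar> \<le> 2 * \<epsilon>"
  proof (cases "prominence H (n - 1)")
    case top
    then have top': "prominence E (n - 1) = top" using HE[of "n - 1"] by (simp add: top_unique)
    have "s = a + \<delta>" "t = b + \<delta>"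
      using top top' a b by (simp_all add: s_def t_def flattening_level_def)
    then show ?thesis using a b ab assms(1,2) top top' by (auto simp: ennreal_less_iff)
  next
    case (real a')
    obtain b' where b': "0 \<le> b'" "prominence E (n - 1) = ennreal b'"
      using EH[of "n - 1"] real assms(1)
      by (cases "prominence E (n - 1)") (auto simp: top_unique simp flip: ennreal_plus)
    have ab': "b' \<le> a' + 2 * \<epsilon>" "a' \<le> b' + 2 * \<epsilon>"
      using EH[of "n - 1"] HE[of "n - 1"] real b' assms(1) by (simp_all flip: ennreal_plus)
    have "a < a'" using less a real by (simp add: ennreal_less_iff)
    then have "\<epsilon> < (a' - a) / 16"
      using gap' a real assms(1) by (simp add: ennreal_minus ennreal_divide_numeral ennreal_less_iff)
    moreover have "s = (a' + a) / 2"
      using a real by (simp add: s_def flattening_level_def ennreal_divide_numeral flip: ennreal_plus)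
    moreover have "t = (b' + b) / 2"
      using b b' by (simp add: t_def flattening_level_def ennreal_divide_numeral flip: ennreal_plus)
    ultimately show ?thesis using a b real b' ab ab' assms(1)
      by (auto simp: ennreal_less_iff simp del: ennreal_plus)
  qed
  then show *: "0 < s" "prominence H n < ennreal s" "ennreal (s + 6 * \<epsilon>) < prominence H (n - 1)"
    "0 < t" "prominence E n < ennreal t" "ennreal (t + 6 * \<epsilon>) < prominence E (n - 1)" "\<bar>s - t\<bar> \<le> 2 * \<epsilon>"
    by auto
  have "ennreal t \<le> ennreal (t + 6 * \<epsilon>)" using assms(1) by (simp add: ennreal_leI)
  then have "ennreal t \<in> gap E n" using *(5,6) by (auto simp: gap_def)
  then show "gap E n \<noteq> {}" by blast
qed

text \<open>The ancestor of \<open>A\<close> at \<open>r - \<sigma>\<close> crosses to level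
  \<open>r - \<sigma> + \<epsilon>\<close>, and it witnesses the pruned image if it arrives by
  \<open>r + \<eta> - \<tau>\<close>. For \<eta> = 3\<epsilon> this tolerates pruning levels that
  differ by 2\<epsilon>.\<close>

lemma prune_image:
  assumes "hc Z G" "hc Z F" and G_F: "\<And>r A. A \<in> G r \<Longrightarrow> \<exists>B\<in>F (r + \<epsilon>). A \<subseteq> B"
    and "0 \<le> \<sigma>" "0 \<le> \<tau>" "\<epsilon> \<le> \<eta>" "\<tau> \<le> \<sigma> + (\<eta> - \<epsilon>)"
    and A: "A \<in> prune \<sigma> G r"
  shows "\<exists>B\<in>prune \<tau> F (r + \<eta>). A \<subseteq> B"
proof -
  interpret G: hc Z G by fact
  interpret F: hc Z F by fact
  obtain A0 where A0: "A0 \<in> G (r - \<sigma>)" "A0 \<subseteq> A" and Ar: "A \<in> G r"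
    using A G.prune_eq[OF assms(4)] by blast
  obtain B' where B': "B' \<in> F (r + \<epsilon>)" "A \<subseteq> B'" using G_F[OF Ar] by blast
  obtain B where B: "B \<in> F (r + \<eta>)" "B' \<subseteq> B" using F.up[OF B'(1), of "r + \<eta>"] assms(6) by auto
  obtain C' where C': "C' \<in> F (r - \<sigma> + \<epsilon>)" "A0 \<subseteq> C'" using G_F[OF A0(1)] by blast
  obtain C where C: "C \<in> F (r + \<eta> - \<tau>)" "C' \<subseteq> C"
    using F.up[OF C'(1), of "r + \<eta> - \<tau>"] assms(7) by auto
  have "C \<inter> B \<noteq> {}" using A0 B' B C' C G.nonempty[OF A0(1)] by blast
  then have "C \<subseteq> B" using F.overlap[OF C(1) B(1)] assms(5) by simp
  then have "B \<in> prune \<tau> F (r + \<eta>)" using F.prune_eq[OF assms(5)] B(1) C(1) by blast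
  then show ?thesis using B'(2) B(2) by blast
qed

text \<open>A cluster \<open>B\<close> of \<open>F\<close> with an ancestor
  \<open>\<tau> + 2 * \<epsilon>\<close> earlier factors through \<open>G\<close>: the ancestor
  enters \<open>G\<close> after \<epsilon>, spends \<tau> there, and after another \<epsilon> is
  back inside \<open>B\<close>. The cluster of \<open>G\<close> reached in between survives pruning
  by \<tau> and has a leaf below it.\<close>

lemma card_leaves_prune_interleaved:
  assumes "hc Z G" "hc Z F"
    and G_F: "\<And>r A. A \<in> G r \<Longrightarrow> \<exists>B\<in>F (r + \<epsilon>). A \<subseteq> B"
    and F_G: "\<And>r A. A \<in> F r \<Longrightarrow> \<exists>B\<in>G (r + \<epsilon>). A \<subseteq> B"
    and "0 \<le> \<epsilon>" "0 \<le> \<tau>" and fin: "finite (leaves (prune \<tau> G))" and root: "rooted (prune \<tau> G)"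
  shows "card (leaves (prune (\<tau> + 2 * \<epsilon>) F)) \<le> card (leaves (prune \<tau> G))"
proof -
  interpret G: hc Z G by fact
  interpret F: hc Z F by fact
  have pos: "0 \<le> \<tau> + 2 * \<epsilon>" using assms by simp
  interpret PG: hc Z "prune \<tau> G" using G.hc_prune assms(6) .
  interpret PF: hc Z "prune (\<tau> + 2 * \<epsilon>) F" using F.hc_prune[OF pos] .
  show ?thesis
  proof (rule card_leaves_le[OF PG.hc_axioms PF.hc_axioms fin])
    fix c assume c: "c \<in> leaves (prune (\<tau> + 2 * \<epsilon>) F)"
    obtain r B where rB: "(r, B) \<in> c" using PF.leaf_nonempty[OF c] by blast
    then obtain B0 where Br: "B \<in> F r" and B0: "B0 \<in> F (r - (\<tau> + 2 * \<epsilon>))" "B0 \<subseteq> B"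
      using PF.leaf_level[OF c rB] F.prune_eq[OF pos] by blast
    have "\<exists>C0\<in>G (r - (\<tau> + 2 * \<epsilon>) + \<epsilon>). B0 \<subseteq> C0" using F_G[OF B0(1)] .
    moreover have "r - (\<tau> + 2 * \<epsilon>) + \<epsilon> = r - \<epsilon> - \<tau>" by simp
    ultimately obtain C0 where C0: "C0 \<in> G (r - \<epsilon> - \<tau>)" "B0 \<subseteq> C0" by metis
    obtain C where C: "C \<in> G (r - \<epsilon>)" "C0 \<subseteq> C" using G.up[OF C0(1), of "r - \<epsilon>"] assms(6) by auto
    obtain D where D: "D \<in> F (r - \<epsilon> + \<epsilon>)" "C \<subseteq> D" using G_F[OF C(1)] by blast
    have "D \<inter> B \<noteq> {}" using B0 C0 C D F.nonempty[OF B0(1)] by blast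
    then have DB: "D = B" using F.same_level[of D r B] D(1) Br by simp
    have "C \<in> prune \<tau> G (r - \<epsilon>)" using C C0(1) G.prune_eq[OF assms(6)] by blast
    from PG.leaf_below[OF root this]
    obtain d q A where "d \<in> leaves (prune \<tau> G)" "(q, A) \<in> d" "A \<subseteq> C" by blast
    moreover have "C \<subseteq> B" using D(2) DB by blast
    ultimately show "\<exists>r B d q A. (r, B) \<in> c \<and> d \<in> leaves (prune \<tau> G) \<and> (q, A) \<in> d \<and> A \<subseteq> B"
      using rB by blast
  qed
qed

section \<open>Leaf counts and lifetimes under pullback\<close>

locale ess_finite_pullback = ess_finite_hc X H + hc_pullback X H Z \<psi>
  for X :: "'a set" and H and Z :: "'c set" and \<psi>
begin

lemma hc_pullback_prune: "0 \<le> \<tau> \<Longrightarrow> hc_pullback X (prune \<tau> H) Z \<psi>"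
  using hc_prune[of \<tau>] surj by (simp add: hc_pullback_def hc_pullback_axioms_def)

lemma leaves_prune_pullback:
  "0 \<le> \<tau> \<Longrightarrow> leaves (prune \<tau> (pullback Z \<psi> H)) = pullback_pc Z \<psi> ` leaves (prune \<tau> H)"
  using hc_pullback.leaves_pullback[OF hc_pullback_prune] by (simp add: prune_pullback)

lemma bij_pullback_pc:
  "0 \<le> \<tau> \<Longrightarrow> bij_betw (pullback_pc Z \<psi>) (leaves (prune \<tau> H)) (leaves (prune \<tau> (pullback Z \<psi> H)))"
  unfolding leaves_prune_pullback
  by (rule inj_on_imp_bij_betw) (rule hc_pullback.inj_pullback_pc[OF hc_pullback_prune])

lemma card_leaves_prune_pullback:
  "0 \<le> \<tau> \<Longrightarrow> card (leaves (prune \<tau> (pullback Z \<psi> H))) = num_leaves \<tau>"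
  using bij_betw_same_card[OF bij_pullback_pc] by simp

lemma finite_leaves_pullback: "0 < \<tau> \<Longrightarrow> finite (leaves (prune \<tau> (pullback Z \<psi> H)))"
  using finite_leaves leaves_prune_pullback by simp

lemma rooted_prune_pullback: "0 < \<tau> \<Longrightarrow> rooted (prune \<tau> (pullback Z \<psi> H))"
  using hc_pullback.rooted_pullback[OF hc_pullback_prune rooted_prune] by (simp add: prune_pullback)

lemma long_life_pullback:
  assumes "0 < \<tau>" "0 \<le> \<eta>" "num_leaves (\<tau> + \<eta>) = num_leaves \<tau>"
    and c: "c \<in> leaves (prune \<tau> (pullback Z \<psi> H))"
  shows "\<exists>r A A'. (r, A) \<in> c \<and> (r + \<eta>, A') \<in> c"
proof -
  interpret Q: hc Z "prune \<tau> (pullback Z \<psi> H)" using P.hc_prune assms(1) by simp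
  have "prune \<eta> (prune \<tau> (pullback Z \<psi> H)) = prune (\<tau> + \<eta>) (pullback Z \<psi> H)"
    using P.prune_prune assms by simp
  then have "card (leaves (prune \<eta> (prune \<tau> (pullback Z \<psi> H)))) = card (leaves (prune \<tau> (pullback Z \<psi> H)))"
    using card_leaves_prune_pullback assms by simp
  then show ?thesis
    using Q.leaf_long_life[OF rooted_prune_pullback[OF assms(1)] assms(2) finite_leaves_pullback[OF assms(1)] _ c]
    by blast
qed

end

section \<open>The matching on the original clusterings\<close>

theorem theorem84:
  fixes X :: "'a set" and Y :: "'b set"
    and H :: "real \<Rightarrow> 'a set set" and E :: "real \<Rightarrow> 'b set set"
    and R :: "('a \<times> 'b) set" and n :: nat and \<epsilon> \<delta> :: real
  assumes "hier_clustering X UNIV H" and "essentially_finite H"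
    and "hier_clustering Y UNIV E" and "essentially_finite E"
    and "correspondence X Y R"
    and "n \<ge> 1"
    and "0 \<le> \<epsilon>" and "ennreal \<epsilon> < gapsize H n / 16"
    and "interleaved_wrt R \<epsilon> UNIV H UNIV E"
    and "0 < \<delta>"
  shows "gap E n \<noteq> {} \<and>
    (\<exists>m. bij_betw m (PF \<delta> H n) (PF \<delta> E n) \<and>
       (\<forall>c\<in>PF \<delta> H n.
          interleaved_wrt R (3 * \<epsilon>) (life c) (pc_hc c) (life (m c)) (pc_hc (m c))))"
proof -
  interpret H: ess_finite_pullback X H R fst
    by unfold_locales (use assms in \<open>auto simp: correspondence_def\<close>)
  interpret E: ess_finite_pullback Y E R snd
    by unfold_locales (use assms in \<open>auto simp: correspondence_def\<close>)
  define H' where "H' = pullback R fst H"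
  define E' where "E' = pullback R snd E"
  have hc': "hc R H'" "hc R E'" unfolding H'_def E'_def by (rule H.hc_pullback E.hc_pullback)+
  have H_E: "\<exists>B\<in>E' (r + \<epsilon>). A \<subseteq> B" if "A \<in> H' r" for A r
    using assms(9) that by (simp add: interleaved_wrt_def interleaved_def hc_ext_def refines_def H'_def E'_def)
  have E_H: "\<exists>B\<in>H' (r + \<epsilon>). A \<subseteq> B" if "A \<in> E' r" for A r
    using assms(9) that by (simp add: interleaved_wrt_def interleaved_def hc_ext_def refines_def H'_def E'_def)
  have cardH: "card (leaves (prune \<tau> H')) = H.num_leaves \<tau>" if "0 \<le> \<tau>" for \<tau>
    using H.card_leaves_prune_pullback[OF that] by (simp add: H'_def)
  have cardE: "card (leaves (prune \<tau> E')) = E.num_leaves \<tau>" if "0 \<le> \<tau>" for \<tau>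
    using E.card_leaves_prune_pullback[OF that] by (simp add: E'_def)
  have num_E_H: "E.num_leaves (\<tau> + 2 * \<epsilon>) \<le> H.num_leaves \<tau>" if "0 < \<tau>" for \<tau>
    using card_leaves_prune_interleaved[OF hc' H_E E_H assms(7), of \<tau>]
      H.finite_leaves_pullback[OF that] H.rooted_prune_pullback[OF that] cardH cardE that assms(7)
    by (simp add: H'_def)
  have num_H_E: "H.num_leaves (\<tau> + 2 * \<epsilon>) \<le> E.num_leaves \<tau>" if "0 < \<tau>" for \<tau>
    using card_leaves_prune_interleaved[OF hc'(2,1) E_H H_E assms(7), of \<tau>]
      E.finite_leaves_pullback[OF that] E.rooted_prune_pullback[OF that] cardH cardE that assms(7)
    by (simp add: E'_def)
  have "0 \<le> 2 * \<epsilon>" using assms(7) by simp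
  note prom = prominence_le_if_num_leaves_le[OF H.ess_finite_hc_axioms E.ess_finite_hc_axioms this num_E_H]
    prominence_le_if_num_leaves_le[OF E.ess_finite_hc_axioms H.ess_finite_hc_axioms this num_H_E]
  define s where "s = flattening_level \<delta> H n"
  define t where "t = flattening_level \<delta> E n"
  note lv = flattening_levels[OF assms(7,10,8) prom, folded s_def t_def]
  have 6: "0 \<le> 6 * \<epsilon>" using assms(7) by simp
  have mono: "ennreal x \<le> ennreal (x + 6 * \<epsilon>)" for x using 6 by (simp add: ennreal_leI)
  have "H.num_leaves s = n" "H.num_leaves (s + 6 * \<epsilon>) = n"
    using H.num_leaves_in_gap[OF lv(1) assms(6) lv(2) order_le_less_trans[OF mono lv(3)]]
      H.num_leaves_in_gap[OF _ assms(6) order_less_le_trans[OF lv(2) mono] lv(3)] lv(1) 6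
    by simp_all
  \<comment> \<open>The length 6\<epsilon> is written as twice 3\<epsilon>, the return trip for the
    interleaving of the pruned clusterings.\<close>
  then have longH: "\<exists>r A A'. (r, A) \<in> c \<and> (r + 2 * (3 * \<epsilon>), A') \<in> c" if "c \<in> leaves (prune s H')" for c
    using H.long_life_pullback[OF lv(1) 6] that by (simp add: H'_def)
  have "E.num_leaves t = n" "E.num_leaves (t + 6 * \<epsilon>) = n"
    using E.num_leaves_in_gap[OF lv(4) assms(6) lv(5) order_le_less_trans[OF mono lv(6)]]
      E.num_leaves_in_gap[OF _ assms(6) order_less_le_trans[OF lv(5) mono] lv(6)] lv(4) 6
    by simp_all
  then have longE: "\<exists>r A A'. (r, A) \<in> c \<and> (r + 2 * (3 * \<epsilon>), A') \<in> c" if "c \<in> leaves (prune t E')" for c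
    using E.long_life_pullback[OF lv(4) 6] that by (simp add: E'_def)
  interpret pair: hc_pair R "prune s H'" "prune t E'" "3 * \<epsilon>"
  proof (intro hc_pair.intro hc_pair_axioms.intro)
    show "hc R (prune s H')" "hc R (prune t E')" using hc.hc_prune hc' lv(1,4) by (auto intro: less_imp_le)
    show "rooted (prune s H')" "rooted (prune t E')"
      using H.rooted_prune_pullback[OF lv(1)] E.rooted_prune_pullback[OF lv(4)] by (simp_all add: H'_def E'_def)
    show "\<exists>B\<in>prune t E' (r + 3 * \<epsilon>). A \<subseteq> B" if "A \<in> prune s H' r" for r A
      by (rule prune_image[OF hc' H_E _ _ _ _ that]) (use lv(1,4,7) assms(7) in auto)
    show "\<exists>B\<in>prune s H' (r + 3 * \<epsilon>). A \<subseteq> B" if "A \<in> prune t E' r" for r A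
      by (rule prune_image[OF hc'(2,1) E_H _ _ _ _ that]) (use lv(1,4,7) assms(7) in auto)
  qed (use assms(7) longH longE in auto)
  obtain m' where m': "bij_betw m' (leaves (prune s H')) (leaves (prune t E'))"
    and int: "\<And>c. c \<in> leaves (prune s H') \<Longrightarrow>
      interleaved R (3 * \<epsilon>) (life c) (pc_hc c) (life (m' c)) (pc_hc (m' c))"
    using pair.leaves_matching by blast
  have PF: "PF \<delta> H n = leaves (prune s H)" "PF \<delta> E n = leaves (prune t E)"
    by (simp_all add: PF_def s_def t_def)
  have bijH: "bij_betw (pullback_pc R fst) (PF \<delta> H n) (leaves (prune s H'))"
    using H.bij_pullback_pc lv(1) unfolding PF H'_def by simp
  have bijE: "bij_betw (pullback_pc R snd) (PF \<delta> E n) (leaves (prune t E'))"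
    using E.bij_pullback_pc lv(4) unfolding PF E'_def by simp
  \<comment> \<open>The matching \<open>m'\<close> relates leaves over \<open>R\<close>; the two
    pullback bijections carry it back to the leaves over \<open>X\<close> and
    \<open>Y\<close>.\<close>
  define m where "m = inv_into (PF \<delta> E n) (pullback_pc R snd) \<circ> (m' \<circ> pullback_pc R fst)"
  have bij: "bij_betw m (PF \<delta> H n) (PF \<delta> E n)"
    unfolding m_def by (intro bij_betw_trans[OF bij_betw_trans[OF bijH m']] bij_betw_inv_into[OF bijE])
  have "interleaved_wrt R (3 * \<epsilon>) (life c) (pc_hc c) (life (m c)) (pc_hc (m c))" if c: "c \<in> PF \<delta> H n" for c
  proof -
    have c': "pullback_pc R fst c \<in> leaves (prune s H')" using bij_betwE[OF bijH] c by blast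
    have mc: "m c \<in> PF \<delta> E n" using bij_betwE[OF bij] c by blast
    have eq: "pullback_pc R snd (m c) = m' (pullback_pc R fst c)"
      using bij_betw_inv_into_right[OF bijE] bij_betwE[OF m'] c' by (simp add: m_def)
    have extH: "hc_ext R (life c) (pullback R fst (pc_hc c)) =
      hc_ext R (life (pullback_pc R fst c)) (pc_hc (pullback_pc R fst c))"
      using hc_pullback.hc_ext_pullback_pc[OF H.hc_pullback_prune[OF less_imp_le[OF lv(1)]]] c
      unfolding PF by blast
    have extE: "hc_ext R (life (m c)) (pullback R snd (pc_hc (m c))) =
      hc_ext R (life (pullback_pc R snd (m c))) (pc_hc (pullback_pc R snd (m c)))"
      using hc_pullback.hc_ext_pullback_pc[OF E.hc_pullback_prune[OF less_imp_le[OF lv(4)]]] mc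
      unfolding PF by blast
    show ?thesis
      using int[OF c'] unfolding interleaved_wrt_def interleaved_def extH extE eq by blast
  qed
  then show ?thesis using bij lv(8) by blast
qed

end
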